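(* Let $R$ be a principal ideal domain and $f\in R[[X]]$. Then $f$ is irreducible in $R[[X]]$ if and only if one of the following holds: (1) $f_0=0$ and $f_1$ is a unit in $R$; (2) $f_0$ is associate to a power of some prime $\pi\in R$ and, writing $f=\pi^kf'$ with $k\ge 0$ and $f'\in R[[X]]$ not divisible by $\pi$, either (a) $k=1$ and $f'_0$ is a unit in $R$, or (b) $k=0$ and the Weierstrass polynomial $P_{f,\widehat{R}_{(\pi)}}$ is irreducible in $\widehat{R}_{(\pi)}[X]$. Moreover, if $f_0$ is associate to a power of a prime $\pi\in R$ and $\pi\nmid f$ in $R[[X]]$, then $R[[X]]/(f)\cong\widehat{R}_{(\pi)}[X]/(P)$ as $R[X]$-algebras, where $P=P_{f,\widehat{R}_{(\pi)}}$.
   Context: $f_i$ denotes the coefficient of $X^i$. A nonzero element $a$ is prime if $(a)$ is a prime ideal. $\widehat{R}_{(\pi)}$ is the $\pi$-adic completion of $R$. For a ring $S$ complete with respect to the $\mathfrak a$-adic filtration (or more generally some filtration by ideals each containing a power of $\mathfrak a$) and $g\in S[[X]]$ with $g_i\in\mathfrak a$ for $i<n$ and $g_n$ a unit mod $\mathfrak a$, $P_{g,S}$ denotes the unique monic polynomial $P\in S[X]$ with $P_i\in\mathfrak a$ for $i<\deg P$ such that $g=UP$ for a unit $U\in S[[X]]$ (the Weierstrass polynomial associated to $g$). Here $S=\widehat{R}_{(\pi)}$, $\mathfrak a=\pi\widehat{R}_{(\pi)}$; when $\pi\nmid f$ in $R[[X]]$ some coefficient of $f$ is not divisible by $\pi$,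 so $f$ is $\pi\widehat{R}_{(\pi)}$-distinguished of some order in $\widehat{R}_{(\pi)}[[X]]$. *)

theory Defs
  imports "HOL-Computational_Algebra.Polynomial_FPS" "HOL-Algebra.UnivPoly"
    "HOL-Algebra.Ring_Divisibility" "HOL-Algebra.QuotRing"
begin

text \<open>A commutative ring (type) in which every ideal is principal.
  Together with the sort idom this expresses that the type is a principal ideal domain.\<close>
definition all_ideals_principal :: "'a::comm_ring_1 itself \<Rightarrow> bool" where
  "all_ideals_principal _ \<longleftrightarrow>
     (\<forall>I::'a set. (0 \<in> I \<and> (\<forall>x\<in>I. \<forall>y\<in>I. x + y \<in> I) \<and> (\<forall>x\<in>I. \<forall>r. r * x \<in> I))
        \<longrightarrow> (\<exists>a. I = {r * a | r. True}))"

definition pi_coset :: "'a::comm_ring_1 \<Rightarrow> nat \<Rightarrow> 'a \<Rightarrow> 'a set" where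
  "pi_coset p n x = {y. p ^ n dvd (y - x)}"

text \<open>The pi-adic completion of R, realised as the inverse limit of the rings R/(pi^n):
  compatible sequences of residue classes, with componentwise operations.\<close>
definition padic_completion :: "'a::comm_ring_1 \<Rightarrow> (nat \<Rightarrow> 'a set) ring" where
  "padic_completion p =
    \<lparr> carrier = {a. (\<forall>n. \<exists>x. a n = pi_coset p n x) \<and> (\<forall>n. a (Suc n) \<subseteq> a n)},
      mult = (\<lambda>a b n. {z. \<exists>x\<in>a n. \<exists>y\<in>b n. p ^ n dvd (z - x * y)}),
      one = (\<lambda>n. pi_coset p n 1),
      zero = (\<lambda>n. pi_coset p n 0),
      add = (\<lambda>a b n. {z. \<exists>x\<in>a n. \<exists>y\<in>b n. p ^ n dvd (z - (x + y))}) \<rparr>"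

definition completion_map :: "'a::comm_ring_1 \<Rightarrow> 'a \<Rightarrow> nat \<Rightarrow> 'a set" where
  "completion_map p x = (\<lambda>n. pi_coset p n x)"

text \<open>Formal power series ring S[[X]] over a ring S (HOL-Algebra style);
  polynomials of UP S are exactly its finitely supported elements.\<close>
definition PS :: "('b, 'm) ring_scheme \<Rightarrow> (nat \<Rightarrow> 'b) ring" where
  "PS S = \<lparr> carrier = {f. \<forall>n. f n \<in> carrier S},
      mult = (\<lambda>f g n. \<Oplus>\<^bsub>S\<^esub>i \<in> {..n}. f i \<otimes>\<^bsub>S\<^esub> g (n - i)),
      one = (\<lambda>i. if i = 0 then \<one>\<^bsub>S\<^esub> else \<zero>\<^bsub>S\<^esub>),
      zero = (\<lambda>i. \<zero>\<^bsub>S\<^esub>),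
      add = (\<lambda>f g n. f n \<oplus>\<^bsub>S\<^esub> g n) \<rparr>"

definition fps_to_completion :: "'a::comm_ring_1 \<Rightarrow> 'a fps \<Rightarrow> nat \<Rightarrow> nat \<Rightarrow> 'a set" where
  "fps_to_completion p f = (\<lambda>n. completion_map p (fps_nth f n))"

definition poly_to_completion :: "'a::comm_ring_1 \<Rightarrow> 'a poly \<Rightarrow> nat \<Rightarrow> nat \<Rightarrow> 'a set" where
  "poly_to_completion p q = (\<lambda>n. completion_map p (Polynomial.coeff q n))"

definition weierstrass_poly :: "'a::comm_ring_1 \<Rightarrow> 'a fps \<Rightarrow> nat \<Rightarrow> nat \<Rightarrow> 'a set" where
  "weierstrass_poly p f =
    (THE P. P \<in> carrier (UP (padic_completion p)) \<and>
       UnivPoly.coeff (UP (padic_completion p)) P (deg (padic_completion p) P)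
         = \<one>\<^bsub>padic_completion p\<^esub> \<and>
       (\<forall>i < deg (padic_completion p) P.
          UnivPoly.coeff (UP (padic_completion p)) P i \<in>
            {completion_map p p \<otimes>\<^bsub>padic_completion p\<^esub> c | c. c \<in> carrier (padic_completion p)}) \<and>
       (\<exists>U \<in> Units (PS (padic_completion p)).
          fps_to_completion p f = U \<otimes>\<^bsub>PS (padic_completion p)\<^esub> P))"

definition fps_ring :: "'a::comm_ring_1 fps ring" where
  "fps_ring = \<lparr> carrier = UNIV, mult = (*), one = 1, zero = 0, add = (+) \<rparr>"

end

theory Submission
  imports Defs
begin

text \<open>
  Write \<open>S\<close> for the completion of \<open>R\<close> at \<open>\<pi>\<close>. An element of \<open>S[[X]]\<close> is a compatible family of power series
  over \<open>R\<close> modulo the powers of \<open>\<pi>\<close>, so Weierstrass division in \<open>S[[X]]\<close> amounts to division in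
  \<open>R[[X]]\<close> modulo each \<open>\<pi>^n\<close>: both parts are unique modulo \<open>\<pi>^n\<close>, hence compatible.

  The link between \<open>R[[X]]\<close> and \<open>S[[X]]\<close> is that \<open>R / (\<pi>^m)\<close> does not change under completion. Suppose the
  constant term of \<open>g\<close> divides \<open>\<pi>^m\<close>. Then every \<open>F\<close> in \<open>S[[X]]\<close> is congruent modulo \<open>g\<close> to an element of
  \<open>R[[X]]\<close>, by solving for the coefficients one at a time. If moreover \<open>g\<close> and a multiple \<open>g V\<close> lie in
  \<open>R[[X]]\<close>, then so does \<open>V\<close>. This gives \<open>R[[X]]/(f) = S[[X]]/(f) = S[[X]]/(P) = S[X]/(P)\<close>. It also turns a
  factorisation \<open>P = A B\<close> over \<open>S\<close> into one of \<open>f\<close> over \<open>R\<close>, because \<open>A\<close> and \<open>B\<close> become elements of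
  \<open>R[[X]]\<close> after multiplication by units of \<open>S[[X]]\<close>; conversely \<open>P\<close> is multiplicative in \<open>f\<close>. Finally, if
  \<open>f\<^sub>0 = a b\<close> with \<open>a\<close> and \<open>b\<close> comaximal, then \<open>f = g h\<close> with \<open>g\<^sub>0 = a\<close> and \<open>h\<^sub>0 = b\<close>, so the constant
  term of an irreducible \<open>f\<close> is zero or associate to a prime power.
\<close>

subsection \<open>Power series over a principal ideal domain\<close>

lemma fps_const_dvd_iff:
  fixes c :: "'a::comm_ring_1"
  shows "fps_const c dvd F \<longleftrightarrow> (\<forall>i. c dvd fps_nth F i)"
proof
  assume "\<forall>i. c dvd fps_nth F i"
  then obtain g where g: "\<And>i. fps_nth F i = c * g i"
    unfolding dvd_def by metis
  have "F = fps_const c * Abs_fps g"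
    by (rule fps_ext) (simp add: g)
  then show "fps_const c dvd F" by simp
qed auto

lemma fps_is_unit_iff:
  fixes f :: "'a::comm_ring_1 fps"
  shows "f dvd 1 \<longleftrightarrow> fps_nth f 0 dvd 1"
proof
  assume "f dvd 1"
  then obtain g where "1 = f * g" by (rule dvdE)
  then have "1 = fps_nth f 0 * fps_nth g 0"
    by (metis fps_mult_nth_0 fps_one_nth)
  then show "fps_nth f 0 dvd 1" by (metis dvd_triv_left)
next
  assume "fps_nth f 0 dvd 1"
  then obtain x where "1 = fps_nth f 0 * x" by (rule dvdE)
  then have "f * fps_right_inverse f x = 1"
    by (intro fps_right_inverse) simp
  then show "f dvd 1" by (metis dvd_triv_left)
qed

lemma fps_X_mult_shift:
  fixes f :: "'a::comm_ring_1 fps"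
  assumes "fps_nth f 0 = 0"
  shows "f = fps_X * fps_shift 1 f"
  using assms by (intro fps_ext) auto

text \<open>In a factorisation f = g h one of the two constant terms vanishes. Only one term of f_1
  = g_0 h_1 + g_1 h_0 is then left, so the other constant term divides a unit.\<close>

lemma irreducible_fps_order_one:
  fixes f :: "'a::idom fps"
  assumes "fps_nth f 0 = 0" "fps_nth f 1 dvd 1"
  shows "Factorial_Ring.irreducible f"
proof (rule Factorial_Ring.irreducibleI)
  show "f \<noteq> 0" using assms(2) by auto
  show "\<not> f dvd 1" using assms(1) by (simp add: fps_is_unit_iff)
  fix g h assume fgh: "f = g * h"
  have *: "fps_nth g 0 dvd 1 \<or> fps_nth h 0 dvd 1" if "fps_nth g 0 = 0 \<or> fps_nth h 0 = 0"
  proof -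
    have "fps_nth f 1 = fps_nth g 0 * fps_nth h 1 + fps_nth g 1 * fps_nth h 0"
      unfolding fgh fps_mult_nth by (simp add: numeral_2_eq_2)
    with that have "fps_nth g 0 dvd fps_nth f 1 \<or> fps_nth h 0 dvd fps_nth f 1" by auto
    with assms(2) show ?thesis by (blast intro: dvd_trans)
  qed
  have "fps_nth g 0 * fps_nth h 0 = 0"
    using assms(1) by (simp add: fgh)
  with * show "g dvd 1 \<or> h dvd 1"
    by (simp add: fps_is_unit_iff)
qed

text \<open>X is not a unit, so in f = X f' the factor f' must be one, and its constant term is
  f_1.\<close>

lemma irreducible_fps_const_0:
  fixes f :: "'a::idom fps"
  assumes "Factorial_Ring.irreducible f" "fps_nth f 0 = 0"
  shows "fps_nth f 1 dvd 1"
proof -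
  have "f = fps_X * fps_shift 1 f" by (rule fps_X_mult_shift) fact
  then have "fps_X dvd (1::'a fps) \<or> fps_shift 1 f dvd 1"
    using assms(1) by (metis Factorial_Ring.irreducibleD)
  then show ?thesis by (auto simp: fps_is_unit_iff)
qed

text \<open>Lifts a factorisation of the constant term. The ansatz g = a + s E, h = b + r E turns f
  = g h into E = f - a b - r s E^2, because r a + s b = 1. With E_0 = 0 this determines E
  coefficient by coefficient.\<close>

lemma fps_factor_of_coprime:
  fixes f :: "'a::comm_ring_1 fps"
  assumes ab: "fps_nth f 0 = a * b" and bez: "r * a + s * b = 1"
  obtains g h where "f = g * h" "fps_nth g 0 = a" "fps_nth h 0 = b"
proof -
  \<comment> \<open>The sum omits both end terms of the convolution: they contain
    \<open>e n\<close>, but with the factor \<open>e 0 = 0\<close>. This is what makes the recursion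
    well founded.\<close>
  let ?Q = "\<lambda>e n x. if n = 0 then x = 0 else
      x = fps_nth f n - r * s * (\<Sum>i=1..<n. e i * e (n - i))"
  have "\<exists>e. \<forall>n. ?Q e n (e n)"
  proof (rule dependent_wellorder_choice)
    show "?Q e n x = ?Q e' n x" if "\<And>y. y < n \<Longrightarrow> e y = e' y" for e e' :: "nat \<Rightarrow> 'a" and n :: nat and x
    proof -
      have "(\<Sum>i=1..<n. e i * e (n - i)) = (\<Sum>i=1..<n. e' i * e' (n - i))"
        by (rule sum.cong) (auto simp: that)
      then show ?thesis by simp
    qed
  qed auto
  then obtain e where e_rec: "\<forall>n. ?Q e n (e n)" ..
  have e0: "e 0 = 0" using e_rec[rule_format, of 0] by simp
  have e: "e n = fps_nth f n - r * s * (\<Sum>i=1..<n. e i * e (n - i))" if "n > 0" for n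
    using e_rec[rule_format, of n] that by simp
  define E where "E = Abs_fps e"
  have E0: "fps_nth E 0 = 0" by (simp add: E_def e0)
  have EE: "fps_nth (E * E) n = (\<Sum>i=1..<n. e i * e (n - i))" if "n > 0" for n
  proof -
    have "fps_nth (E * E) n = (\<Sum>i=0..n. e i * e (n - i))"
      by (simp add: E_def fps_mult_nth)
    also have "\<dots> = (\<Sum>i=1..<n. e i * e (n - i))"
    proof (rule sum.mono_neutral_right)
      show "\<forall>i\<in>{0..n} - {1..<n}. e i * e (n - i) = 0"
      proof
        fix i assume "i \<in> {0..n} - {1..<n}"
        then have "i = 0 \<or> i = n" by auto
        then show "e i * e (n - i) = 0" using e0 by auto
      qed
    qed auto
    finally show ?thesis .
  qed
  have f_eq: "f = fps_const (a * b) + E + fps_const (r * s) * (E * E)"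
  proof (rule fps_ext)
    fix n show "fps_nth f n = fps_nth (fps_const (a * b) + E + fps_const (r * s) * (E * E)) n"
    proof (cases "n = 0")
      case False then show ?thesis
        using e[of n] EE[of n] by (simp add: fps_mult_left_const_nth del: fps_mult_nth_0) (simp add: E_def)
    qed (simp add: ab E0)
  qed
  let ?g = "fps_const a + fps_const s * E" and ?h = "fps_const b + fps_const r * E"
  have "?g * ?h = fps_const (a * b) + fps_const (r * a + s * b) * E + fps_const (r * s) * (E * E)"
    by (simp only: fps_const_mult [symmetric] fps_const_add [symmetric] algebra_simps)
  also have "\<dots> = f" by (simp only: bez f_eq fps_const_1_eq_1 mult_1)
  finally show ?thesis using that[of ?g ?h] E0 by simp
qed

section \<open>Divisibility in a principal ideal domain\<close>

lemma PID_bezout: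
  fixes a b :: "'a::comm_ring_1"
  assumes "all_ideals_principal TYPE('a)"
  obtains d r s where "d = r * a + s * b" "d dvd a" "d dvd b"
proof -
  let ?I = "{r * a + s * b | r s. True}"
  have "\<exists>d. ?I = {r * d | r. True}"
  proof (rule assms[unfolded all_ideals_principal_def, rule_format], intro conjI ballI allI)
    show "0 \<in> ?I" by (simp, metis add_0 mult_zero_left)
    fix x assume "x \<in> ?I"
    then obtain r s where x: "x = r * a + s * b" by auto
    { fix y assume "y \<in> ?I"
      then obtain r' s' where y: "y = r' * a + s' * b" by auto
      show "x + y \<in> ?I"
        by (simp, rule exI[of _ "r + r'"], rule exI[of _ "s + s'"]) (simp add: x y algebra_simps) }
    fix t show "t * x \<in> ?I"
      by (simp, rule exI[of _ "t * r"], rule exI[of _ "t * s"]) (simp add: x algebra_simps)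
  qed
  then obtain d where d: "?I = {r * d | r. True}" by blast
  have "d \<in> ?I" unfolding d by (simp, metis mult_1)
  then obtain r s where 1: "d = r * a + s * b" by auto
  have "a \<in> ?I" by (simp, rule exI[of _ 1], rule exI[of _ 0]) simp
  then have 2: "d dvd a" unfolding d by auto
  have "b \<in> ?I" by (simp, rule exI[of _ 0], rule exI[of _ 1]) simp
  then have 3: "d dvd b" unfolding d by auto
  from 1 2 3 that show ?thesis by blast
qed

text \<open>Ascending chain condition: the union of an infinite chain of principal ideals is
  principal, and its generator already lies in one member of the chain. The minimal elements
  obtained from this replace a prime factorisation.\<close>

lemma PID_wf_dvd:
  assumes "all_ideals_principal TYPE('a::comm_ring_1)"
  shows "wf {(x, y::'a). x dvd y \<and> \<not> y dvd x}"
  unfolding wf_iff_no_infinite_down_chain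
proof
  assume "\<exists>c. \<forall>i. (c (Suc i), c i) \<in> {(x, y::'a). x dvd y \<and> \<not> y dvd x}"
  then obtain c :: "nat \<Rightarrow> 'a" where c: "\<And>i. c (Suc i) dvd c i" "\<And>i. \<not> c i dvd c (Suc i)"
    by auto
  have mono: "c j dvd c i" if "i \<le> j" for i j
    using that by (induction rule: dec_induct) (auto intro: dvd_trans[OF c(1)])
  let ?I = "{x. \<exists>n. c n dvd x}"
  have "\<exists>d. ?I = {r * d | r. True}"
  proof (rule assms[unfolded all_ideals_principal_def, rule_format], intro conjI ballI allI)
    show "0 \<in> ?I" by simp
    fix x assume "x \<in> ?I"
    then obtain n where n: "c n dvd x" by auto
    { fix y assume "y \<in> ?I"
      then obtain m where m: "c m dvd y" by auto
      have "c (max n m) dvd x + y"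
        using n m mono[of n "max n m"] mono[of m "max n m"] by (meson dvd_add dvd_trans max.cobounded1 max.cobounded2)
      then show "x + y \<in> ?I" by blast }
    fix t show "t * x \<in> ?I" using n by (auto intro!: exI[of _ n] dvd_mult)
  qed
  then obtain d where d: "?I = {r * d | r. True}" by blast
  have "d \<in> ?I" unfolding d by (simp, metis mult_1)
  then obtain n where n: "c n dvd d" by auto
  have "c (Suc n) \<in> ?I" by (blast intro: dvd_refl)
  then have "d dvd c (Suc n)" unfolding d by auto
  with n c(2)[of n] show False by (blast intro: dvd_trans)
qed

text \<open>Let d generate the ideal of q and b, and q = d e. If e is a unit, then q divides d and
  hence b. Otherwise d is a unit, and multiplying d = r q + s b by a shows that q divides a.\<close>

lemma PID_irreducible_imp_prime:
  fixes q :: "'a::idom"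
  assumes "all_ideals_principal TYPE('a)" "Factorial_Ring.irreducible q"
  shows "prime_elem q"
proof (rule prime_elemI)
  show "q \<noteq> 0" "\<not> q dvd 1"
    using assms(2) by (auto simp: Factorial_Ring.irreducible_def)
  fix a b assume qab: "q dvd a * b"
  show "q dvd a \<or> q dvd b"
  proof (rule disjCI)
    assume "\<not> q dvd b"
    obtain d r s where d: "d = r * q + s * b" "d dvd q" "d dvd b"
      using PID_bezout[OF assms(1)] by blast
    from d(2) obtain e where e: "q = d * e" by (rule dvdE)
    have "\<not> e dvd 1"
    proof
      assume "e dvd 1"
      then obtain e' where "1 = e * e'" by (rule dvdE)
      then have "d = q * e'" by (simp add: e mult.assoc)
      with d(3) \<open>\<not> q dvd b\<close> show False by auto
    qed
    then have "d dvd 1" using assms(2) e by (auto simp: Factorial_Ring.irreducible_def)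
    then obtain d' where "1 = d * d'" by (rule dvdE)
    then have "a = a * (r * q + s * b) * d'" by (simp add: d(1) mult.assoc)
    also have "\<dots> = q * (a * r * d') + (a * b) * (s * d')" by (simp add: algebra_simps)
    finally show "q dvd a" using qab by (metis dvd_add dvd_triv_left dvd_mult2)
  qed
qed

text \<open>A non-unit divisor of x that is minimal under proper divisibility is irreducible, hence
  prime.\<close>

lemma PID_prime_divisor:
  fixes x :: "'a::idom"
  assumes "all_ideals_principal TYPE('a)" "x \<noteq> 0" "\<not> x dvd 1"
  obtains q where "prime_elem q" "q dvd x"
proof -
  have "x \<in> {y. y dvd x \<and> \<not> y dvd 1}" using assms(3) by simp
  then obtain q where q: "q \<in> {y. y dvd x \<and> \<not> y dvd 1}"
    and min: "\<And>y. (y, q) \<in> {(x, y). x dvd y \<and> \<not> y dvd x} \<Longrightarrow> y \<notin> {y. y dvd x \<and> \<not> y dvd 1}"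
    by (rule wfE_min[OF PID_wf_dvd[OF assms(1)]]) blast
  have "Factorial_Ring.irreducible q"
  proof (rule Factorial_Ring.irreducibleI)
    show "q \<noteq> 0" using q assms(2) by auto
    show "\<not> q dvd 1" using q by auto
    fix a b assume ab: "q = a * b"
    show "a dvd 1 \<or> b dvd 1"
    proof (rule disjCI)
      assume "\<not> b dvd 1"
      moreover have "b dvd x" using q ab by (auto intro: dvd_trans)
      ultimately have "q dvd b" using min[of b] ab by auto
      then obtain t where "b = a * b * t" unfolding ab by (rule dvdE)
      then have "b * 1 = b * (a * t)" by (metis mult.commute mult.left_commute mult_1)
      moreover have "b \<noteq> 0" using q ab assms(2) by auto
      ultimately have "a * t = 1" by (metis mult_cancel_left)
      then show "a dvd 1" by (metis dvd_triv_left)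
    qed
  qed
  with PID_irreducible_imp_prime[OF assms(1)] q that show ?thesis by blast
qed

text \<open>A cofactor c that is minimal under proper divisibility cannot be divisible by q, since
  the quotient by q would be a smaller cofactor.\<close>

lemma PID_prime_power_factor:
  fixes x :: "'a::idom"
  assumes "all_ideals_principal TYPE('a)" "x \<noteq> 0" "prime_elem q"
  obtains m c where "x = q ^ m * c" "\<not> q dvd c"
proof -
  have "x \<in> {c. \<exists>m. x = q ^ m * c}" by (auto intro: exI[of _ 0])
  then obtain c where c: "c \<in> {c. \<exists>m. x = q ^ m * c}"
    and min: "\<And>y. (y, c) \<in> {(x, y). x dvd y \<and> \<not> y dvd x} \<Longrightarrow> y \<notin> {c. \<exists>m. x = q ^ m * c}"
    by (rule wfE_min[OF PID_wf_dvd[OF assms(1)]]) blast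
  from c obtain m where m: "x = q ^ m * c" by auto
  have "\<not> q dvd c"
  proof
    assume "q dvd c"
    then obtain y where y: "c = q * y" by (rule dvdE)
    have "x = q ^ Suc m * y" by (simp add: m y mult_ac)
    then have "y \<in> {c. \<exists>m. x = q ^ m * c}" by blast
    with min[of y] y have "c dvd y" by auto
    then obtain t where "y = q * y * t" unfolding y by (rule dvdE)
    then have "y * 1 = y * (q * t)" by (metis mult.commute mult.left_commute mult_1)
    moreover have "y \<noteq> 0" using assms(2) m y by auto
    ultimately have "q * t = 1" by (metis mult_cancel_left)
    with assms(3) show False by (metis dvd_triv_left prime_elem_not_unit)
  qed
  with m that show ?thesis by blast
qed

text \<open>Let d generate the ideal of q and x, and q = d e. The prime q does not divide d, so it
  divides e, and cancelling q shows that d is a unit.\<close>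

lemma PID_inverse_mod_prime:
  fixes x :: "'a::idom"
  assumes "all_ideals_principal TYPE('a)" "prime_elem q" "\<not> q dvd x"
  shows "\<exists>y. q dvd x * y - 1"
proof -
  obtain d r s where d: "d = r * q + s * x" "d dvd q" "d dvd x"
    using PID_bezout[OF assms(1)] by blast
  obtain e where e: "q = d * e" using d(2) by (rule dvdE)
  have "\<not> q dvd d" using d(3) assms(3) by (blast intro: dvd_trans)
  then have "q dvd e" using assms(2) e by (metis dvd_refl prime_elem_dvd_multD)
  then obtain d' where "e = q * d'" by (rule dvdE)
  with e have "q * 1 = q * (d * d')" by (metis mult.left_commute mult_1_right)
  moreover have "q \<noteq> 0" using assms(2) by (simp add: prime_elem_def)
  ultimately have "1 = d * d'" by (metis mult_cancel_left)
  then have "x * (s * d') - 1 = q * (- (r * d'))" by (simp add: d(1) algebra_simps)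
  then show ?thesis by (metis dvd_triv_left)
qed

text \<open>The step multiplies the term r q^n by 1 = c y - q t. The ring is general because the
  lemma serves both for R and for R[[X]] with \<open>q = fps_const p\<close>.\<close>

lemma coprime_of_inverse_mod:
  fixes q c :: "'a::comm_ring_1"
  assumes "q dvd c * y - 1"
  shows "\<exists>r s. r * q ^ n + s * c = 1"
proof (induction n)
  case 0 show ?case by (rule exI[of _ 1], rule exI[of _ 0]) simp
next
  case (Suc n)
  then obtain r s where rs: "r * q ^ n + s * c = 1" by blast
  obtain t where t: "c * y - 1 = q * t" using assms by (rule dvdE)
  then have 1: "c * y - q * t = 1" by (simp add: algebra_simps)
  have "1 = r * q ^ n * (c * y - q * t) + s * c" by (simp add: 1 rs)
  also have "\<dots> = (- r * t) * q ^ Suc n + (r * q ^ n * y + s) * c"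
    by (simp add: algebra_simps)
  finally show ?case by metis
qed

text \<open>Write f_0 = q^m c with q not dividing c. Then q^m and c are comaximal and the
  factorisation lifts to f = g h. As m > 0, g is not a unit, so h is one, and hence so is c.\<close>

lemma irreducible_fps_const_primepow:
  fixes f :: "'a::idom fps"
  assumes pid: "all_ideals_principal TYPE('a)" and irr: "Factorial_Ring.irreducible f"
    and f0: "fps_nth f 0 \<noteq> 0"
  obtains q m where "prime_elem q" "fps_nth f 0 dvd q ^ m" "q ^ m dvd fps_nth f 0"
proof -
  have "\<not> fps_nth f 0 dvd 1"
    using irr by (auto simp: Factorial_Ring.irreducible_def fps_is_unit_iff)
  then obtain q where q: "prime_elem q" "q dvd fps_nth f 0"
    using PID_prime_divisor[OF pid f0] by blast
  obtain m c where mc: "fps_nth f 0 = q ^ m * c" "\<not> q dvd c"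
    using PID_prime_power_factor[OF pid f0 q(1)] by blast
  obtain y where "q dvd c * y - 1" using PID_inverse_mod_prime[OF pid q(1) mc(2)] by blast
  then obtain r s where "r * q ^ m + s * c = 1" using coprime_of_inverse_mod by blast
  then obtain g h where gh: "f = g * h" "fps_nth g 0 = q ^ m" "fps_nth h 0 = c"
    using fps_factor_of_coprime[OF mc(1)] by blast
  have "m \<noteq> 0" using mc q(2) by (intro notI) auto
  then have "\<not> q ^ m dvd 1"
    using q(1) by (meson dvd_power dvd_trans neq0_conv prime_elem_not_unit)
  then have "c dvd 1" using irr gh by (metis Factorial_Ring.irreducibleD fps_is_unit_iff)
  then obtain c' where "1 = c * c'" by (rule dvdE)
  then have "q ^ m = fps_nth f 0 * c'" by (metis mc(1) mult.assoc mult_1_right)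
  then show ?thesis using that[OF q(1), of m] mc(1) by (metis dvd_triv_left)
qed


section \<open>Division of power series modulo powers of a prime\<close>

locale padic =
  fixes p :: "'a::comm_ring_1"

text \<open>The residue ring R/(p) is a field; it is in this form that the principal ideal
  hypothesis enters the local theory.\<close>

locale prime_residue_field = padic p for p :: "'a::idom" +
  assumes prime: "prime_elem p"
    and inverse_mod: "\<And>x. \<not> p dvd x \<Longrightarrow> \<exists>y. p dvd x * y - 1"
begin

lemma p_nonzero [simp]: "p \<noteq> 0"
  using prime by (simp add: prime_elem_def)

lemma fps_inverse_mod:
  assumes "\<not> p dvd fps_nth G 0"
  obtains W where "fps_const p dvd G * W - 1"
proof -
  obtain y where "p dvd fps_nth G 0 * y - 1" using inverse_mod[OF assms] by blast
  then obtain t where t: "fps_nth G 0 * y - 1 = p * t" by (rule dvdE)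
  \<comment> \<open>\<open>?H\<close> agrees with \<open>G * fps_const y\<close> modulo p but has
    constant term exactly 1, so it is invertible in R[[X]] itself.\<close>
  let ?H = "G * fps_const y - fps_const (p * t)"
  have "fps_nth ?H 0 = 1" using t by (simp add: algebra_simps)
  then have "?H dvd 1" by (simp add: fps_is_unit_iff)
  then obtain W where W: "1 = ?H * W" by (rule dvdE)
  then have "G * (fps_const y * W) - 1 = G * (fps_const y * W) - ?H * W" by simp
  also have "\<dots> = fps_const p * (fps_const t * W)"
    by (simp add: fps_const_mult [symmetric] algebra_simps del: fps_const_mult)
  finally show ?thesis using that by (metis dvd_triv_left)
qed

text \<open>An inverse modulo p makes \<open>fps_const p\<close> and \<open>G\<close> comaximal in
  R[[X]], hence also \<open>fps_const p ^ n\<close> and \<open>G\<close>.\<close>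

lemma fps_inverse_mod_power:
  assumes "\<not> p dvd fps_nth G 0"
  shows "\<exists>W. fps_const (p ^ n) dvd G * W - 1"
proof -
  obtain W where "fps_const p dvd G * W - 1" using fps_inverse_mod[OF assms] .
  then obtain r s where "r * fps_const p ^ n + s * G = 1"
    using coprime_of_inverse_mod by blast
  then have "G * s - 1 = fps_const (p ^ n) * (- r)"
    by (simp add: fps_const_power algebra_simps)
  then show ?thesis by (metis dvd_triv_left)
qed

text \<open>The order of f modulo p is d. As R/(p) is a field, being a unit modulo p is expressed as
  not being divisible by p.\<close>

definition distinguished :: "nat \<Rightarrow> 'a fps \<Rightarrow> bool" where
  "distinguished d f \<longleftrightarrow> (\<forall>i<d. p dvd fps_nth f i) \<and> \<not> p dvd fps_nth f d"

lemma distinguished_exists: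
  assumes "\<not> fps_const p dvd f"
  obtains d where "distinguished d f"
proof -
  have "\<exists>d. \<not> p dvd fps_nth f d" using assms by (simp add: fps_const_dvd_iff)
  then have "distinguished (LEAST d. \<not> p dvd fps_nth f d) f"
    unfolding distinguished_def using LeastI_ex[of "\<lambda>d. \<not> p dvd fps_nth f d"]
    by (auto dest: not_less_Least)
  then show ?thesis by (rule that)
qed

text \<open>Modulo p the series is X^d times \<open>fps_shift d f\<close>, whose constant term is
  invertible modulo p. All divisions by f start from this form.\<close>

lemma distinguished_mod:
  assumes "distinguished d f"
  obtains l where "f = fps_X ^ d * fps_shift d f + fps_const p * l"
proof -
  have "fps_const p dvd f - fps_X ^ d * fps_shift d f"
    unfolding fps_const_dvd_iff using assms
    by (auto simp: distinguished_def fps_X_power_mult_nth)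
  then obtain l where "f - fps_X ^ d * fps_shift d f = fps_const p * l" by (rule dvdE)
  then have "f = fps_X ^ d * fps_shift d f + fps_const p * l" by (simp add: algebra_simps)
  then show ?thesis by (rule that)
qed

text \<open>Modulo p, f is X^d times a unit with inverse W, so g is divided by cutting it at degree
  d and multiplying the upper part by W. Dividing the error term in the same way raises the
  precision from p^n to p^(n+1).\<close>

lemma weierstrass_division_mod:
  assumes "distinguished d f"
  shows "\<exists>q r. (\<forall>i\<ge>d. fps_nth r i = 0) \<and> fps_const (p ^ n) dvd g - (f * q + r)"
proof (induction n)
  case 0 show ?case by (intro exI[of _ 0]) simp
next
  case (Suc n)
  have step: "\<exists>q r h. (\<forall>i\<ge>d. fps_nth r i = 0) \<and> g = f * q + r + fps_const p * h" for g
  proof -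
    obtain l where l: "f = fps_X ^ d * fps_shift d f + fps_const p * l"
      using distinguished_mod[OF assms] .
    have "\<not> p dvd fps_nth (fps_shift d f) 0" using assms by (simp add: distinguished_def)
    then obtain W where "fps_const p dvd fps_shift d f * W - 1" using fps_inverse_mod by blast
    then obtain t where t: "fps_shift d f * W - 1 = fps_const p * t" by (rule dvdE)
    let ?q = "W * fps_shift d g" and ?r = "fps_cutoff d g"
    have "f * ?q = (fps_X ^ d * fps_shift d f + fps_const p * l) * ?q" using l by simp
    also have "\<dots> = fps_X ^ d * fps_shift d g + fps_X ^ d * fps_shift d g * (fps_shift d f * W - 1)
        + fps_const p * l * ?q"
      by (simp add: algebra_simps)
    also have "\<dots> = (g - ?r) + fps_const p * (fps_X ^ d * fps_shift d g * t + l * ?q)"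
    proof -
      have "g - ?r = fps_X ^ d * fps_shift d g"
        by (rule fps_ext) (simp add: fps_X_power_mult_nth)
      then show ?thesis unfolding t by (simp only: distrib_left ac_simps)
    qed
    finally have "g = f * ?q + ?r + fps_const p * (- (fps_X ^ d * fps_shift d g * t + l * ?q))"
      by (simp add: algebra_simps)
    moreover have "\<forall>i\<ge>d. fps_nth ?r i = 0" by simp
    ultimately show ?thesis by blast
  qed
  obtain q r where r: "\<forall>i\<ge>d. fps_nth r i = 0" and "fps_const (p ^ n) dvd g - (f * q + r)"
    using Suc by blast
  then obtain g1 where g1: "g - (f * q + r) = fps_const (p ^ n) * g1" by (blast elim: dvdE)
  obtain q1 r1 h where r1: "\<forall>i\<ge>d. fps_nth r1 i = 0" and h: "g1 = f * q1 + r1 + fps_const p * h"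
    using step by blast
  have "g - (f * (q + fps_const (p ^ n) * q1) + (r + fps_const (p ^ n) * r1))
      = (g - (f * q + r)) - fps_const (p ^ n) * (f * q1 + r1)"
    by (simp add: algebra_simps)
  also have "\<dots> = fps_const (p ^ Suc n) * h"
    unfolding g1 h by (simp add: fps_const_mult [symmetric] algebra_simps del: fps_const_mult)
  finally have "fps_const (p ^ Suc n) dvd
      g - (f * (q + fps_const (p ^ n) * q1) + (r + fps_const (p ^ n) * r1))"
    by (metis dvd_triv_left)
  moreover have "\<forall>i\<ge>d. fps_nth (r + fps_const (p ^ n) * r1) i = 0" using r r1 by simp
  ultimately show ?case by blast
qed

text \<open>Modulo p write f = X^d u. The coefficients of X^d u q + r below d are those of r, the
  others those of u q with u invertible, so q and r vanish modulo p. The induction cancels p^n, as R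
  is a domain.\<close>

lemma weierstrass_division_unique_mod:
  assumes "distinguished d f" "\<forall>i\<ge>d. fps_nth r i = 0" "fps_const (p ^ n) dvd f * q + r"
  shows "fps_const (p ^ n) dvd q \<and> fps_const (p ^ n) dvd r"
  using assms(2,3)
proof (induction n)
  case (Suc n)
  have step: "fps_const p dvd q \<and> fps_const p dvd r"
    if r0: "\<forall>i\<ge>d. fps_nth r i = 0" and dv: "fps_const p dvd f * q + r" for q r
  proof -
    obtain l where l: "f = fps_X ^ d * fps_shift d f + fps_const p * l"
      using distinguished_mod[OF assms(1)] .
    have "fps_X ^ d * (fps_shift d f * q) + r = (fps_X ^ d * fps_shift d f + fps_const p * l) * q + r
        - fps_const p * (l * q)"
      by (simp add: algebra_simps)
    also have "\<dots> = f * q + r - fps_const p * (l * q)" using l by simp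
    also have "fps_const p dvd \<dots>" using dv by (rule dvd_diff) simp
    finally have "fps_const p dvd fps_X ^ d * (fps_shift d f * q) + r" .
    then have coeff: "p dvd fps_nth (fps_X ^ d * (fps_shift d f * q) + r) i" for i
      by (simp only: fps_const_dvd_iff)
    have pr: "p dvd fps_nth r i" for i
      using coeff[of i] r0 by (cases "i < d") (auto simp: fps_X_power_mult_nth)
    have "p dvd fps_nth (fps_shift d f * q) i" for i
      using coeff[of "i + d"] r0 by (simp add: fps_X_power_mult_nth del: fps_mult_nth_0)
    then have uq: "fps_const p dvd fps_shift d f * q" by (simp add: fps_const_dvd_iff)
    have "\<not> p dvd fps_nth (fps_shift d f) 0" using assms(1) by (simp add: distinguished_def)
    then obtain W where "fps_const p dvd fps_shift d f * W - 1" using fps_inverse_mod by blast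
    then have "fps_const p dvd W * (fps_shift d f * q) - q * (fps_shift d f * W - 1)"
      using uq by (meson dvd_diff dvd_mult)
    also have "W * (fps_shift d f * q) - q * (fps_shift d f * W - 1) = q"
      by (simp add: algebra_simps)
    finally show ?thesis using pr by (simp add: fps_const_dvd_iff)
  qed
  have "fps_const (p ^ n) dvd fps_const (p ^ Suc n)" by (simp add: fps_const_dvd_iff)
  then have "fps_const (p ^ n) dvd f * q + r" using Suc.prems(2) by (rule dvd_trans)
  with Suc obtain q' r' where q': "q = fps_const (p ^ n) * q'" and r': "r = fps_const (p ^ n) * r'"
    by (meson dvdE)
  have pow: "fps_const (p ^ Suc n) = fps_const (p ^ n) * fps_const p" by (simp add: mult.commute)
  have nz: "fps_const (p ^ n) \<noteq> 0" by simp
  have "\<forall>i\<ge>d. fps_nth r' i = 0" using Suc.prems(1) r' by simp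
  moreover have "fps_const p dvd f * q' + r'"
  proof -
    have "fps_const (p ^ n) * fps_const p dvd fps_const (p ^ n) * (f * q' + r')"
      using Suc.prems(2) unfolding pow q' r' by (simp add: algebra_simps del: fps_const_mult)
    then show ?thesis using nz by (simp only: dvd_mult_cancel_left) simp
  qed
  ultimately have "fps_const p dvd q' \<and> fps_const p dvd r'" by (rule step)
  then show ?case unfolding q' r' pow by (auto intro: mult_dvd_mono simp del: fps_const_mult)
qed simp

text \<open>R need not be complete, so F = f V is solved exactly, one coefficient at a time. The
  hypothesis modulo p^m shows that f_0 divides F_0, which gives a constant g; the hypothesis then
  passes to the series F' with F - f g = X F'.\<close>

lemma fps_dvd_of_dvd_mod_powers:
  assumes f0: "fps_nth f 0 dvd p ^ m" and ex: "\<And>n. \<exists>V. fps_const (p ^ n) dvd F - f * V"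
  shows "f dvd F"
proof -
  let ?D = "\<lambda>F. \<forall>n. \<exists>V. fps_const (p ^ n) dvd F - f * V"
  obtain c where c: "p ^ m = fps_nth f 0 * c" using f0 by (rule dvdE)
  have step: "\<exists>F'. ?D F' \<and> (\<exists>g. F = f * fps_const g + fps_X * F')" if D: "?D F" for F
  proof -
    obtain V where "fps_const (p ^ m) dvd F - f * V" using D by blast
    then have "p ^ m dvd fps_nth F 0 - fps_nth f 0 * fps_nth V 0"
      by (auto simp: fps_const_dvd_iff dest: spec[of _ 0])
    then have "fps_nth f 0 dvd fps_nth F 0 - fps_nth f 0 * fps_nth V 0"
      using c by (metis dvd_mult_left)
    then have "fps_nth f 0 dvd fps_nth F 0"
      by (metis diff_add_cancel dvd_add dvd_triv_left)
    then obtain g where g: "fps_nth F 0 = fps_nth f 0 * g" by (rule dvdE)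
    have "F - f * fps_const g = fps_X * fps_shift 1 (F - f * fps_const g)"
      by (rule fps_X_mult_shift) (simp add: g)
    then obtain F' where F': "F - f * fps_const g = fps_X * F'" by blast
    have "\<exists>V. fps_const (p ^ n) dvd F' - f * V" for n
    proof -
      \<comment> \<open>The extra m in the exponent pays for cancelling f_0, a divisor of p^m, when
        g is compared with the constant term of V.\<close>
      obtain V where V: "fps_const (p ^ (m + n)) dvd F - f * V" using D by blast
      then have "p ^ (m + n) dvd fps_nth F 0 - fps_nth f 0 * fps_nth V 0"
        by (auto simp: fps_const_dvd_iff dest: spec[of _ 0])
      then have "p ^ (m + n) dvd c * (fps_nth f 0 * (g - fps_nth V 0))"
        unfolding g by (metis dvd_mult right_diff_distrib)
      then have "p ^ m * p ^ n dvd p ^ m * (g - fps_nth V 0)"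
        unfolding c by (simp only: power_add c ac_simps)
      then have "p ^ n dvd g - fps_nth V 0" by simp
      then obtain t where t: "g - fps_nth V 0 = p ^ n * t" by (rule dvdE)
      \<comment> \<open>A change of V by a multiple of p^n makes its constant term equal to g, so
        that the difference is divisible by X.\<close>
      have "V - fps_const g + fps_const (p ^ n * t) = fps_X * fps_shift 1 (V - fps_const g + fps_const (p ^ n * t))"
        by (rule fps_X_mult_shift) (simp add: t [symmetric])
      then obtain V' where "V - fps_const g + fps_const (p ^ n * t) = fps_X * V'" by blast
      then have V': "V = fps_const g + fps_X * V' - fps_const (p ^ n) * fps_const t"
        by (simp add: algebra_simps)
      have "fps_const (p ^ n) dvd fps_const (p ^ (m + n))"
        by (simp add: fps_const_dvd_iff power_add)
      then have "fps_const (p ^ n) dvd F - f * V" using V by (rule dvd_trans)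
      also have "F - f * V = (F - f * fps_const g) - f * (fps_X * V') + fps_const (p ^ n) * (f * fps_const t)"
        unfolding V' by (simp add: algebra_simps del: fps_const_mult)
      also have "\<dots> = fps_X * (F' - f * V') + fps_const (p ^ n) * (f * fps_const t)"
        unfolding F' by (simp add: algebra_simps)
      finally have "fps_const (p ^ n) dvd fps_X * (F' - f * V')"
        by (metis dvd_add_left_iff dvd_triv_left)
      then have "p ^ n dvd fps_nth (fps_X * (F' - f * V')) (Suc i)" for i
        by (simp only: fps_const_dvd_iff)
      then have "fps_const (p ^ n) dvd F' - f * V'"
        by (simp only: fps_const_dvd_iff fps_X_mult_nth nat.distinct if_False diff_Suc_1) simp
      then show ?thesis by blast
    qed
    moreover have "F = f * fps_const g + fps_X * F'" using F' by (simp add: algebra_simps)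
    ultimately show ?thesis by blast
  qed
  \<comment> \<open>\<open>H\<close> is the sequence of remainders; the clause
    \<open>k = 0 \<longrightarrow> x = F\<close> of the predicate fixes its start.\<close>
  obtain H where H: "H 0 = F" "\<And>k. ?D (H k)"
    "\<And>k. \<exists>g. H k = f * fps_const g + fps_X * H (Suc k)"
    using dependent_nat_choice[of "\<lambda>k x. ?D x \<and> (k = 0 \<longrightarrow> x = F)"
        "\<lambda>_ F F'. \<exists>g. F = f * fps_const g + fps_X * F'"] step ex by (metis nat.distinct(1))
  obtain g where g: "\<And>k. H k = f * fps_const (g k) + fps_X * H (Suc k)"
    using H(3) by metis
  have part: "F = f * (\<Sum>k<N. fps_const (g k) * fps_X ^ k) + fps_X ^ N * H N" for N
  proof (induction N)
    case (Suc N)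
    show ?case by (subst Suc, subst g) (simp add: algebra_simps)
  qed (simp add: H)
  have "F = f * Abs_fps g"
  proof (rule fps_ext)
    fix n
    \<comment> \<open>The remainder term carries X^(n+1) and does not reach coefficient n.\<close>
    have "fps_nth F n = fps_nth (f * (\<Sum>k<Suc n. fps_const (g k) * fps_X ^ k)) n"
      by (subst part[of "Suc n"]) (simp add: fps_X_power_mult_nth del: power_Suc sum.lessThan_Suc)
    also have "\<dots> = fps_nth (f * Abs_fps g) n"
      unfolding fps_mult_nth
    proof (rule sum.cong)
      fix i assume "i \<in> {0..n}"
      have "fps_nth (\<Sum>k<Suc n. fps_const (g k) * fps_X ^ k) (n - i)
          = (\<Sum>k<Suc n. if n - i = k then g k else 0)"
        unfolding fps_sum_nth by (rule sum.cong) auto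
      also have "\<dots> = g (n - i)" by (subst sum.delta') auto
      finally show "fps_nth f i * fps_nth (\<Sum>k<Suc n. fps_const (g k) * fps_X ^ k) (n - i)
          = fps_nth f i * fps_nth (Abs_fps g) (n - i)" by simp
    qed simp
    finally show "fps_nth F n = fps_nth (f * Abs_fps g) n" .
  qed
  then show ?thesis by (metis dvd_triv_left)
qed

end

subsection \<open>The completion and its power series ring\<close>

context padic
begin

abbreviation "\<R> \<equiv> padic_completion p"
abbreviation "\<S> \<equiv> PS \<R>"
abbreviation "\<iota> \<equiv> completion_map p"
abbreviation "\<phi> \<equiv> fps_to_completion p"

lemma pi_coset_eq_iff: "pi_coset p n x = pi_coset p n y \<longleftrightarrow> p ^ n dvd x - y"
proof
  assume "pi_coset p n x = pi_coset p n y"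
  then have "x \<in> pi_coset p n y" by (metis (mono_tags) pi_coset_def mem_Collect_eq diff_self dvd_0_right)
  then show "p ^ n dvd x - y" by (simp add: pi_coset_def)
next
  assume *: "p ^ n dvd x - y"
  have "p ^ n dvd z - x \<longleftrightarrow> p ^ n dvd z - y" for z
  proof -
    have "z - y = (z - x) + (x - y)" by simp
    then show ?thesis using * by (metis dvd_add_left_iff)
  qed
  then show "pi_coset p n x = pi_coset p n y" by (simp add: pi_coset_def)
qed

text \<open>Inclusion of successive residue classes amounts to a congruence between representatives,
  so elements of the completion can be handled as coherent sequences in R.\<close>

lemma completion_carrier_iff:
  "x \<in> carrier \<R> \<longleftrightarrow> (\<exists>r. \<forall>n. x n = pi_coset p n (r n) \<and> p ^ n dvd r (Suc n) - r n)"
proof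
  assume "x \<in> carrier \<R>"
  then have "\<forall>n. \<exists>a. x n = pi_coset p n a" and sub: "\<And>n. x (Suc n) \<subseteq> x n"
    by (auto simp: padic_completion_def)
  then obtain r where r: "\<And>n. x n = pi_coset p n (r n)" by metis
  have "p ^ n dvd r (Suc n) - r n" for n
  proof -
    have "r (Suc n) \<in> x (Suc n)" by (simp add: r pi_coset_def)
    then have "r (Suc n) \<in> x n" using sub by blast
    then show ?thesis by (simp add: r pi_coset_def)
  qed
  with r show "\<exists>r. \<forall>n. x n = pi_coset p n (r n) \<and> p ^ n dvd r (Suc n) - r n" by blast
next
  assume "\<exists>r. \<forall>n. x n = pi_coset p n (r n) \<and> p ^ n dvd r (Suc n) - r n"
  then obtain r where r: "\<And>n. x n = pi_coset p n (r n)" and c: "\<And>n. p ^ n dvd r (Suc n) - r n"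
    by blast
  have "x (Suc n) \<subseteq> x n" for n
  proof
    fix y assume "y \<in> x (Suc n)"
    then have "p ^ Suc n dvd y - r (Suc n)" by (simp add: r pi_coset_def)
    then have "p ^ n dvd y - r (Suc n)" by (metis dvd_mult_right power_Suc)
    then have "p ^ n dvd (y - r (Suc n)) + (r (Suc n) - r n)" using c by (rule dvd_add)
    then show "y \<in> x n" by (simp add: r pi_coset_def)
  qed
  with r show "x \<in> carrier \<R>" by (auto simp: padic_completion_def)
qed

lemma completion_rep: "x \<in> carrier \<R> \<Longrightarrow> \<exists>r. x n = pi_coset p n r"
  by (auto simp: padic_completion_def)

lemma completion_rep_Suc:
  assumes "x \<in> carrier \<R>" "x (Suc n) = pi_coset p (Suc n) r"
  shows "x n = pi_coset p n r"
proof -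
  obtain s where s: "x n = pi_coset p n s" using completion_rep[OF assms(1)] by blast
  have "r \<in> x (Suc n)" by (simp add: assms(2) pi_coset_def)
  moreover have "x (Suc n) \<subseteq> x n" using assms(1) by (simp add: padic_completion_def)
  ultimately have "r \<in> pi_coset p n s" using s by blast
  then have "pi_coset p n r = pi_coset p n s" by (subst pi_coset_eq_iff) (simp add: pi_coset_def)
  with s show ?thesis by simp
qed

lemma completion_rep_le:
  assumes "x \<in> carrier \<R>" "x n = pi_coset p n r" "m \<le> n"
  shows "x m = pi_coset p m r"
  using assms(3,2) by (induction rule: inc_induct) (use completion_rep_Suc[OF assms(1)] in blast)+

text \<open>The sum is defined through all pairs of members of two cosets; a single pair of
  representatives already determines it.\<close>

lemma completion_add_nth:
  assumes "x n = pi_coset p n a" "y n = pi_coset p n b"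
  shows "(x \<oplus>\<^bsub>\<R>\<^esub> y) n = pi_coset p n (a + b)"
proof -
  have "p ^ n dvd z - (u + v) \<longleftrightarrow> p ^ n dvd z - (a + b)" if "p ^ n dvd u - a" "p ^ n dvd v - b" for z u v
  proof -
    have "z - (a + b) = (z - (u + v)) + ((u - a) + (v - b))" by (simp add: algebra_simps)
    then show ?thesis using that by (metis dvd_add dvd_add_left_iff)
  qed
  moreover have "p ^ n dvd a - a" for a by simp
  ultimately have "(\<exists>u. p ^ n dvd u - a \<and> (\<exists>v. p ^ n dvd v - b \<and> p ^ n dvd z - (u + v)))
      \<longleftrightarrow> p ^ n dvd z - (a + b)" for z by blast
  then show ?thesis
    using assms by (auto simp: padic_completion_def pi_coset_def)
qed

lemma completion_mult_nth:
  assumes "x n = pi_coset p n a" "y n = pi_coset p n b"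
  shows "(x \<otimes>\<^bsub>\<R>\<^esub> y) n = pi_coset p n (a * b)"
proof -
  have "p ^ n dvd z - u * v \<longleftrightarrow> p ^ n dvd z - a * b" if "p ^ n dvd u - a" "p ^ n dvd v - b" for z u v
  proof -
    have "z - a * b = (z - u * v) + ((u - a) * v + a * (v - b))" by (simp add: algebra_simps)
    then show ?thesis using that by (metis dvd_add dvd_add_left_iff dvd_mult dvd_mult2)
  qed
  moreover have "p ^ n dvd a - a" for a by simp
  ultimately have "(\<exists>u. p ^ n dvd u - a \<and> (\<exists>v. p ^ n dvd v - b \<and> p ^ n dvd z - u * v))
      \<longleftrightarrow> p ^ n dvd z - a * b" for z by blast
  then show ?thesis
    using assms by (auto simp: padic_completion_def pi_coset_def)
qed

lemma completion_one_nth: "\<one>\<^bsub>\<R>\<^esub> n = pi_coset p n 1"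
  and completion_zero_nth: "\<zero>\<^bsub>\<R>\<^esub> n = pi_coset p n 0"
  by (simp_all add: padic_completion_def)

lemma completion_map_nth: "\<iota> x n = pi_coset p n x"
  by (simp add: completion_map_def)

lemmas completion_nth = completion_one_nth completion_zero_nth completion_map_nth
  completion_add_nth completion_mult_nth

lemma completion_map_closed [simp, intro]: "\<iota> x \<in> carrier \<R>"
  unfolding completion_carrier_iff by (rule exI[of _ "\<lambda>_. x"]) (simp add: completion_map_def)

lemma completion_add_closed:
  assumes "x \<in> carrier \<R>" "y \<in> carrier \<R>" shows "x \<oplus>\<^bsub>\<R>\<^esub> y \<in> carrier \<R>"
proof -
  obtain r s where r: "\<And>n. x n = pi_coset p n (r n)" "\<And>n. p ^ n dvd r (Suc n) - r n"
    and s: "\<And>n. y n = pi_coset p n (s n)" "\<And>n. p ^ n dvd s (Suc n) - s n"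
    using assms unfolding completion_carrier_iff by blast
  have "p ^ n dvd (r (Suc n) + s (Suc n)) - (r n + s n)" for n
    using dvd_add[OF r(2)[of n] s(2)[of n]] by (simp add: algebra_simps)
  then show ?thesis unfolding completion_carrier_iff
    by (intro exI[of _ "\<lambda>n. r n + s n"]) (simp add: completion_add_nth r(1) s(1))
qed

lemma completion_mult_closed:
  assumes "x \<in> carrier \<R>" "y \<in> carrier \<R>" shows "x \<otimes>\<^bsub>\<R>\<^esub> y \<in> carrier \<R>"
proof -
  obtain r s where r: "\<And>n. x n = pi_coset p n (r n)" "\<And>n. p ^ n dvd r (Suc n) - r n"
    and s: "\<And>n. y n = pi_coset p n (s n)" "\<And>n. p ^ n dvd s (Suc n) - s n"
    using assms unfolding completion_carrier_iff by blast
  have "p ^ n dvd r (Suc n) * s (Suc n) - r n * s n" for n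
    using dvd_add[OF dvd_mult2[OF r(2)[of n], of "s (Suc n)"] dvd_mult[OF s(2)[of n], of "r n"]]
    by (simp add: algebra_simps)
  then show ?thesis unfolding completion_carrier_iff
    by (intro exI[of _ "\<lambda>n. r n * s n"]) (simp add: completion_mult_nth r(1) s(1))
qed

lemma completion_map_one: "\<iota> 1 = \<one>\<^bsub>\<R>\<^esub>"
  and completion_map_zero: "\<iota> 0 = \<zero>\<^bsub>\<R>\<^esub>"
  and completion_map_add: "\<iota> (x + y) = \<iota> x \<oplus>\<^bsub>\<R>\<^esub> \<iota> y"
  and completion_map_mult: "\<iota> (x * y) = \<iota> x \<otimes>\<^bsub>\<R>\<^esub> \<iota> y"
  by (rule ext; simp add: completion_nth)+

lemma completion_mult_comm:
  assumes "x \<in> carrier \<R>" "y \<in> carrier \<R>"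
  shows "x \<otimes>\<^bsub>\<R>\<^esub> y = y \<otimes>\<^bsub>\<R>\<^esub> x"
proof (rule ext)
  fix n
  obtain a b where "x n = pi_coset p n a" "y n = pi_coset p n b"
    using assms completion_rep by metis
  then show "(x \<otimes>\<^bsub>\<R>\<^esub> y) n = (y \<otimes>\<^bsub>\<R>\<^esub> x) n"
    by (simp add: completion_mult_nth mult.commute)
qed

text \<open>Each identity is checked at every level on representatives, where it is an identity of
  R.\<close>

lemma completion_cring: "cring \<R>"
proof (rule cringI)
  show "abelian_group \<R>"
  proof (rule abelian_groupI)
    show "\<zero>\<^bsub>\<R>\<^esub> \<in> carrier \<R>" using completion_map_closed[of 0] by (simp add: completion_map_zero)
    fix x assume x: "x \<in> carrier \<R>"
    show "\<zero>\<^bsub>\<R>\<^esub> \<oplus>\<^bsub>\<R>\<^esub> x = x"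
    proof (rule ext)
      fix n
      obtain a where "x n = pi_coset p n a" using x completion_rep by metis
      then show "(\<zero>\<^bsub>\<R>\<^esub> \<oplus>\<^bsub>\<R>\<^esub> x) n = x n" by (simp add: completion_nth)
    qed
    show "\<exists>y\<in>carrier \<R>. y \<oplus>\<^bsub>\<R>\<^esub> x = \<zero>\<^bsub>\<R>\<^esub>"
    proof
      show "\<iota> (- 1) \<otimes>\<^bsub>\<R>\<^esub> x \<in> carrier \<R>" using x by (simp add: completion_mult_closed)
      show "(\<iota> (- 1) \<otimes>\<^bsub>\<R>\<^esub> x) \<oplus>\<^bsub>\<R>\<^esub> x = \<zero>\<^bsub>\<R>\<^esub>"
      proof (rule ext)
        fix n
        obtain a where a: "x n = pi_coset p n a" using x completion_rep by metis
        then have "(\<iota> (- 1) \<otimes>\<^bsub>\<R>\<^esub> x) n = pi_coset p n (- 1 * a)"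
          by (intro completion_mult_nth completion_map_nth)
        then show "((\<iota> (- 1) \<otimes>\<^bsub>\<R>\<^esub> x) \<oplus>\<^bsub>\<R>\<^esub> x) n = \<zero>\<^bsub>\<R>\<^esub> n"
          using a by (simp add: completion_add_nth completion_zero_nth)
      qed
    qed
    fix y assume y: "y \<in> carrier \<R>"
    show "x \<oplus>\<^bsub>\<R>\<^esub> y \<in> carrier \<R>" using x y by (rule completion_add_closed)
    show "x \<oplus>\<^bsub>\<R>\<^esub> y = y \<oplus>\<^bsub>\<R>\<^esub> x"
    proof (rule ext)
      fix n
      obtain a b where "x n = pi_coset p n a" "y n = pi_coset p n b"
        using x y completion_rep by metis
      then show "(x \<oplus>\<^bsub>\<R>\<^esub> y) n = (y \<oplus>\<^bsub>\<R>\<^esub> x) n" by (simp add: completion_add_nth add.commute)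
    qed
    fix z assume z: "z \<in> carrier \<R>"
    show "x \<oplus>\<^bsub>\<R>\<^esub> y \<oplus>\<^bsub>\<R>\<^esub> z = x \<oplus>\<^bsub>\<R>\<^esub> (y \<oplus>\<^bsub>\<R>\<^esub> z)"
    proof (rule ext)
      fix n
      obtain a b c where abc: "x n = pi_coset p n a" "y n = pi_coset p n b" "z n = pi_coset p n c"
        using x y z completion_rep by metis
      show "(x \<oplus>\<^bsub>\<R>\<^esub> y \<oplus>\<^bsub>\<R>\<^esub> z) n = (x \<oplus>\<^bsub>\<R>\<^esub> (y \<oplus>\<^bsub>\<R>\<^esub> z)) n"
        using abc by (simp add: completion_nth add.assoc)
    qed
  qed
  show "comm_monoid \<R>"
  proof (rule comm_monoidI)
    show "\<one>\<^bsub>\<R>\<^esub> \<in> carrier \<R>" using completion_map_closed[of 1] by (simp add: completion_map_one)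
    fix x assume x: "x \<in> carrier \<R>"
    show "\<one>\<^bsub>\<R>\<^esub> \<otimes>\<^bsub>\<R>\<^esub> x = x"
    proof (rule ext)
      fix n
      obtain a where "x n = pi_coset p n a" using x completion_rep by metis
      then show "(\<one>\<^bsub>\<R>\<^esub> \<otimes>\<^bsub>\<R>\<^esub> x) n = x n" by (simp add: completion_nth)
    qed
    fix y assume y: "y \<in> carrier \<R>"
    show "x \<otimes>\<^bsub>\<R>\<^esub> y \<in> carrier \<R>" using x y by (rule completion_mult_closed)
    show "x \<otimes>\<^bsub>\<R>\<^esub> y = y \<otimes>\<^bsub>\<R>\<^esub> x" using x y by (rule completion_mult_comm)
    fix z assume z: "z \<in> carrier \<R>"
    show "x \<otimes>\<^bsub>\<R>\<^esub> y \<otimes>\<^bsub>\<R>\<^esub> z = x \<otimes>\<^bsub>\<R>\<^esub> (y \<otimes>\<^bsub>\<R>\<^esub> z)"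
    proof (rule ext)
      fix n
      obtain a b c where abc: "x n = pi_coset p n a" "y n = pi_coset p n b" "z n = pi_coset p n c"
        using x y z completion_rep by metis
      show "(x \<otimes>\<^bsub>\<R>\<^esub> y \<otimes>\<^bsub>\<R>\<^esub> z) n = (x \<otimes>\<^bsub>\<R>\<^esub> (y \<otimes>\<^bsub>\<R>\<^esub> z)) n"
        using abc by (simp add: completion_nth mult.assoc)
    qed
  qed
  fix x y z assume x: "x \<in> carrier \<R>" and y: "y \<in> carrier \<R>" and z: "z \<in> carrier \<R>"
  show "(x \<oplus>\<^bsub>\<R>\<^esub> y) \<otimes>\<^bsub>\<R>\<^esub> z = x \<otimes>\<^bsub>\<R>\<^esub> z \<oplus>\<^bsub>\<R>\<^esub> y \<otimes>\<^bsub>\<R>\<^esub> z"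
  proof (rule ext)
    fix n
    obtain a b c where abc: "x n = pi_coset p n a" "y n = pi_coset p n b" "z n = pi_coset p n c"
      using x y z completion_rep by metis
    show "((x \<oplus>\<^bsub>\<R>\<^esub> y) \<otimes>\<^bsub>\<R>\<^esub> z) n = (x \<otimes>\<^bsub>\<R>\<^esub> z \<oplus>\<^bsub>\<R>\<^esub> y \<otimes>\<^bsub>\<R>\<^esub> z) n"
      using abc by (simp add: completion_nth algebra_simps)
  qed
qed

sublocale R: cring \<R> by (rule completion_cring)

section \<open>Power series over the completion and their lifts modulo powers of
  \<open>p\<close>\<close>

lemma completion_finsum_nth:
  assumes "finite A" "\<And>i. i \<in> A \<Longrightarrow> x i \<in> carrier \<R>" "\<And>i. i \<in> A \<Longrightarrow> x i n = pi_coset p n (r i)"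
  shows "(\<Oplus>\<^bsub>\<R>\<^esub>i\<in>A. x i) n = pi_coset p n (\<Sum>i\<in>A. r i)"
  using assms by (induction A rule: finite_induct)
    (auto simp: completion_zero_nth R.finsum_insert Pi_def intro!: completion_add_nth)

text \<open>\<open>G\<close> lifts the reduction of \<open>F\<close> modulo p^n to R[[X]] and
  matters only modulo p^n. Such lifts translate statements about \<open>\<S>\<close> into
  congruences in R[[X]].\<close>

definition represents :: "nat \<Rightarrow> (nat \<Rightarrow> nat \<Rightarrow> 'a set) \<Rightarrow> 'a fps \<Rightarrow> bool" where
  "represents n F G \<longleftrightarrow> (\<forall>i. F i n = pi_coset p n (fps_nth G i))"

lemma PS_carrier: "F \<in> carrier \<S> \<longleftrightarrow> (\<forall>i. F i \<in> carrier \<R>)"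
  by (simp add: PS_def)

lemma PS_mult: "(F \<otimes>\<^bsub>\<S>\<^esub> G) i = (\<Oplus>\<^bsub>\<R>\<^esub>j\<in>{..i}. F j \<otimes>\<^bsub>\<R>\<^esub> G (i - j))"
  and PS_add: "(F \<oplus>\<^bsub>\<S>\<^esub> G) i = F i \<oplus>\<^bsub>\<R>\<^esub> G i"
  and PS_one: "\<one>\<^bsub>\<S>\<^esub> i = (if i = 0 then \<one>\<^bsub>\<R>\<^esub> else \<zero>\<^bsub>\<R>\<^esub>)"
  and PS_zero: "\<zero>\<^bsub>\<S>\<^esub> i = \<zero>\<^bsub>\<R>\<^esub>"
  by (simp_all add: PS_def)

lemma PS_mult_closed: "F \<in> carrier \<S> \<Longrightarrow> G \<in> carrier \<S> \<Longrightarrow> F \<otimes>\<^bsub>\<S>\<^esub> G \<in> carrier \<S>"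
  by (simp add: PS_carrier PS_mult R.finsum_closed Pi_def)

lemma represents_ex: "F \<in> carrier \<S> \<Longrightarrow> \<exists>G. represents n F G"
proof -
  assume "F \<in> carrier \<S>"
  then have "\<forall>i. \<exists>r. F i n = pi_coset p n r" using completion_rep by (simp add: PS_carrier)
  then obtain r where "\<And>i. F i n = pi_coset p n (r i)" by metis
  then have "represents n F (Abs_fps r)" by (simp add: represents_def)
  then show ?thesis ..
qed

lemma represents_iff:
  "represents n F G \<Longrightarrow> represents n F G' \<longleftrightarrow> fps_const (p ^ n) dvd G - G'"
  by (simp add: represents_def fps_const_dvd_iff pi_coset_eq_iff)

lemma represents_dvd:
  "represents n F G \<Longrightarrow> represents n F G' \<Longrightarrow> fps_const (p ^ n) dvd G - G'"
  using represents_iff by blast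

lemma represents_le:
  "F \<in> carrier \<S> \<Longrightarrow> represents n F G \<Longrightarrow> m \<le> n \<Longrightarrow> represents m F G"
  unfolding represents_def PS_carrier using completion_rep_le by blast

text \<open>The completion is separated: sharing a lift at every level forces equality.\<close>

lemma represents_eqI:
  assumes "\<And>n. \<exists>G. represents n F G \<and> represents n F' G"
  shows "F = F'"
proof (rule ext, rule ext)
  fix i n show "F i n = F' i n" using assms[of n] by (auto simp: represents_def)
qed

text \<open>Completeness: coherent lifts assemble into a series over the completion.\<close>

lemma represents_lift:
  assumes "\<And>n. fps_const (p ^ n) dvd G (Suc n) - G n"
  obtains F where "F \<in> carrier \<S>" "\<And>n. represents n F (G n)"
proof -
  let ?F = "\<lambda>i n. pi_coset p n (fps_nth (G n) i)"
  have "?F \<in> carrier \<S>"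
    unfolding PS_carrier completion_carrier_iff
  proof
    fix i
    show "\<exists>r. \<forall>n. pi_coset p n (fps_nth (G n) i) = pi_coset p n (r n) \<and> p ^ n dvd r (Suc n) - r n"
      using assms by (intro exI[of _ "\<lambda>n. fps_nth (G n) i"]) (simp add: fps_const_dvd_iff)
  qed
  moreover have "represents n ?F (G n)" for n by (simp add: represents_def)
  ultimately show ?thesis by (rule that)
qed

text \<open>Solutions modulo every \<open>p ^ n\<close> that are unique modulo \<open>p ^ n\<close> are automatically compatible.\<close>
lemma represents_lift_unique:
  assumes ex: "\<And>n. \<exists>G. Q n G"
    and mono: "\<And>n G. Q (Suc n) G \<Longrightarrow> Q n G"
    and unique: "\<And>n G G'. Q n G \<Longrightarrow> Q n G' \<Longrightarrow> fps_const (p ^ n) dvd G - G'"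
  obtains F where "F \<in> carrier \<S>" "\<And>n. \<exists>G. Q n G \<and> represents n F G"
proof -
  obtain G where G: "\<And>n. Q n (G n)" using ex by metis
  have "fps_const (p ^ n) dvd G (Suc n) - G n" for n
    by (rule unique[OF mono[OF G] G])
  then obtain F where "F \<in> carrier \<S>" "\<And>n. represents n F (G n)" by (rule represents_lift) blast
  with G that show ?thesis by blast
qed

lemma represents_add:
  "represents n F G \<Longrightarrow> represents n F' G' \<Longrightarrow> represents n (F \<oplus>\<^bsub>\<S>\<^esub> F') (G + G')"
  by (simp add: represents_def PS_add completion_add_nth)

lemma represents_mult:
  assumes "F \<in> carrier \<S>" "F' \<in> carrier \<S>" "represents n F G" "represents n F' G'"
  shows "represents n (F \<otimes>\<^bsub>\<S>\<^esub> F') (G * G')"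
  unfolding represents_def
proof
  fix i
  have "(\<Oplus>\<^bsub>\<R>\<^esub>j\<in>{..i}. F j \<otimes>\<^bsub>\<R>\<^esub> F' (i - j)) n = pi_coset p n (\<Sum>j\<in>{..i}. fps_nth G j * fps_nth G' (i - j))"
    using assms by (intro completion_finsum_nth)
      (auto simp: PS_carrier represents_def intro!: completion_mult_nth)
  then show "(F \<otimes>\<^bsub>\<S>\<^esub> F') i n = pi_coset p n (fps_nth (G * G') i)"
    by (simp add: PS_mult fps_mult_nth atLeast0AtMost)
qed

lemma represents_one: "represents n \<one>\<^bsub>\<S>\<^esub> 1"
  and represents_zero: "represents n \<zero>\<^bsub>\<S>\<^esub> 0"
  by (simp_all add: represents_def PS_one PS_zero completion_nth)

lemma represents_map: "represents n (\<phi> G) G"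
  by (simp add: represents_def fps_to_completion_def completion_map_nth)

lemma fps_map_closed [simp, intro]: "\<phi> G \<in> carrier \<S>"
  by (simp add: PS_carrier fps_to_completion_def)

text \<open>Laws of addition hold coefficientwise. Laws involving the convolution product are read
  off from lifts in R[[X]], which avoids rearranging double sums over the completion.\<close>

lemma PS_cring: "cring \<S>"
proof (rule cringI)
  show "abelian_group \<S>"
  proof (rule abelian_groupI)
    show "\<zero>\<^bsub>\<S>\<^esub> \<in> carrier \<S>" by (simp add: PS_carrier PS_zero)
    fix x assume x: "x \<in> carrier \<S>"
    then show "\<zero>\<^bsub>\<S>\<^esub> \<oplus>\<^bsub>\<S>\<^esub> x = x" by (intro ext) (simp add: PS_carrier PS_zero PS_add)
    show "\<exists>y\<in>carrier \<S>. y \<oplus>\<^bsub>\<S>\<^esub> x = \<zero>\<^bsub>\<S>\<^esub>"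
      using x by (intro bexI[of _ "\<lambda>i. \<ominus>\<^bsub>\<R>\<^esub> x i"] ext) (simp_all add: PS_carrier PS_zero PS_add R.l_neg)
    fix y assume y: "y \<in> carrier \<S>"
    show "x \<oplus>\<^bsub>\<S>\<^esub> y \<in> carrier \<S>" using x y by (simp add: PS_carrier PS_add)
    show "x \<oplus>\<^bsub>\<S>\<^esub> y = y \<oplus>\<^bsub>\<S>\<^esub> x"
      using x y by (intro ext) (simp add: PS_carrier PS_add R.a_comm)
    fix z assume z: "z \<in> carrier \<S>"
    show "x \<oplus>\<^bsub>\<S>\<^esub> y \<oplus>\<^bsub>\<S>\<^esub> z = x \<oplus>\<^bsub>\<S>\<^esub> (y \<oplus>\<^bsub>\<S>\<^esub> z)"
      using x y z by (intro ext) (simp add: PS_carrier PS_add R.a_assoc)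
  qed
  show "comm_monoid \<S>"
  proof (rule comm_monoidI)
    show "\<one>\<^bsub>\<S>\<^esub> \<in> carrier \<S>" by (simp add: PS_carrier PS_one)
    fix x assume x: "x \<in> carrier \<S>"
    show "\<one>\<^bsub>\<S>\<^esub> \<otimes>\<^bsub>\<S>\<^esub> x = x"
    proof (rule represents_eqI)
      fix n
      obtain X where X: "represents n x X" using represents_ex[OF x] by blast
      show "\<exists>G. represents n (\<one>\<^bsub>\<S>\<^esub> \<otimes>\<^bsub>\<S>\<^esub> x) G \<and> represents n x G"
        using represents_mult[OF \<open>\<one>\<^bsub>\<S>\<^esub> \<in> carrier \<S>\<close> x represents_one X] X by auto
    qed
    fix y assume y: "y \<in> carrier \<S>"
    show "x \<otimes>\<^bsub>\<S>\<^esub> y \<in> carrier \<S>" using x y by (rule PS_mult_closed)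
    show "x \<otimes>\<^bsub>\<S>\<^esub> y = y \<otimes>\<^bsub>\<S>\<^esub> x"
    proof (rule represents_eqI)
      fix n
      obtain X Y where XY: "represents n x X" "represents n y Y"
        using represents_ex x y by metis
      show "\<exists>G. represents n (x \<otimes>\<^bsub>\<S>\<^esub> y) G \<and> represents n (y \<otimes>\<^bsub>\<S>\<^esub> x) G"
        using represents_mult[OF x y XY] represents_mult[OF y x XY(2,1)]
        by (auto simp: mult.commute)
    qed
    fix z assume z: "z \<in> carrier \<S>"
    show "x \<otimes>\<^bsub>\<S>\<^esub> y \<otimes>\<^bsub>\<S>\<^esub> z = x \<otimes>\<^bsub>\<S>\<^esub> (y \<otimes>\<^bsub>\<S>\<^esub> z)"
    proof (rule represents_eqI)
      fix n
      obtain X Y Z where X: "represents n x X" and Y: "represents n y Y" and Z: "represents n z Z"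
        using represents_ex x y z by metis
      show "\<exists>G. represents n (x \<otimes>\<^bsub>\<S>\<^esub> y \<otimes>\<^bsub>\<S>\<^esub> z) G \<and> represents n (x \<otimes>\<^bsub>\<S>\<^esub> (y \<otimes>\<^bsub>\<S>\<^esub> z)) G"
        using represents_mult[OF PS_mult_closed[OF x y] z represents_mult[OF x y X Y] Z]
          represents_mult[OF x PS_mult_closed[OF y z] X represents_mult[OF y z Y Z]]
        by (auto simp: mult.assoc)
    qed
  qed
  fix x y z assume x: "x \<in> carrier \<S>" and y: "y \<in> carrier \<S>" and z: "z \<in> carrier \<S>"
  have xy: "x \<oplus>\<^bsub>\<S>\<^esub> y \<in> carrier \<S>" using x y by (simp add: PS_carrier PS_add)
  show "(x \<oplus>\<^bsub>\<S>\<^esub> y) \<otimes>\<^bsub>\<S>\<^esub> z = x \<otimes>\<^bsub>\<S>\<^esub> z \<oplus>\<^bsub>\<S>\<^esub> y \<otimes>\<^bsub>\<S>\<^esub> z"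
  proof (rule represents_eqI)
    fix n
    obtain X Y Z where X: "represents n x X" and Y: "represents n y Y" and Z: "represents n z Z"
      using represents_ex x y z by metis
    show "\<exists>G. represents n ((x \<oplus>\<^bsub>\<S>\<^esub> y) \<otimes>\<^bsub>\<S>\<^esub> z) G \<and> represents n (x \<otimes>\<^bsub>\<S>\<^esub> z \<oplus>\<^bsub>\<S>\<^esub> y \<otimes>\<^bsub>\<S>\<^esub> z) G"
      using represents_mult[OF xy z represents_add[OF X Y] Z]
        represents_add[OF represents_mult[OF x z X Z] represents_mult[OF y z Y Z]]
      by (auto simp: distrib_right)
  qed
qed

sublocale S: cring \<S> by (rule PS_cring)

lemma represents_minus:
  assumes F: "F \<in> carrier \<S>" and F': "F' \<in> carrier \<S>" and "represents n F G" "represents n F' G'"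
  shows "represents n (F \<ominus>\<^bsub>\<S>\<^esub> F') (G - G')"
proof -
  obtain H where H: "represents n (F \<ominus>\<^bsub>\<S>\<^esub> F') H" using represents_ex F F' by blast
  have "(F \<ominus>\<^bsub>\<S>\<^esub> F') \<oplus>\<^bsub>\<S>\<^esub> F' = F" using F F' by (simp add: a_minus_def S.a_assoc S.l_neg)
  with represents_add[OF H assms(4)] have "represents n F (H + G')" by simp
  then have "fps_const (p ^ n) dvd H + G' - G" using assms(3) represents_dvd by blast
  moreover have "H + G' - G = H - (G - G')" by simp
  ultimately have "fps_const (p ^ n) dvd H - (G - G')" by simp
  with H show ?thesis using represents_iff by blast
qed

lemma fps_map_mult: "\<phi> (F * G) = \<phi> F \<otimes>\<^bsub>\<S>\<^esub> \<phi> G"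
  by (rule represents_eqI) (blast intro: represents_map represents_mult fps_map_closed)

lemma fps_map_add: "\<phi> (F + G) = \<phi> F \<oplus>\<^bsub>\<S>\<^esub> \<phi> G"
  by (rule represents_eqI) (blast intro: represents_map represents_add)

lemma fps_map_one: "\<phi> 1 = \<one>\<^bsub>\<S>\<^esub>"
  by (rule represents_eqI) (blast intro: represents_map represents_one)

lemma PS_UnitsI:
  assumes "F \<in> carrier \<S>" "G \<in> carrier \<S>" "F \<otimes>\<^bsub>\<S>\<^esub> G = \<one>\<^bsub>\<S>\<^esub>"
  shows "F \<in> Units \<S>"
  using assms S.m_comm[of G F] by (auto simp: Units_def)

lemma fps_map_unit: "G dvd 1 \<Longrightarrow> \<phi> G \<in> Units \<S>"
proof -
  assume "G dvd 1"
  then obtain H where "1 = G * H" by (rule dvdE)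
  then have "\<phi> G \<otimes>\<^bsub>\<S>\<^esub> \<phi> H = \<one>\<^bsub>\<S>\<^esub>" by (simp flip: fps_map_mult fps_map_one)
  then show ?thesis by (intro PS_UnitsI) auto
qed

text \<open>Polynomials are literally the finitely supported series with the same operations, so
  \<open>UP \<R>\<close> lies in \<open>\<S>\<close> without an embedding.\<close>

lemma up_carrier_PS: "Q \<in> carrier (UP \<R>) \<Longrightarrow> Q \<in> carrier \<S>"
  by (auto simp: UP_def PS_carrier)

lemma up_carrierI:
  assumes "Q \<in> carrier \<S>" "\<And>i. i > n \<Longrightarrow> Q i = \<zero>\<^bsub>\<R>\<^esub>"
  shows "Q \<in> carrier (UP \<R>)"
  using assms by (auto simp: UP_def PS_carrier up_def bound_def)

lemma up_mult_PS:
  "Q \<in> carrier (UP \<R>) \<Longrightarrow> Q' \<in> carrier (UP \<R>) \<Longrightarrow> Q \<otimes>\<^bsub>UP \<R>\<^esub> Q' = Q \<otimes>\<^bsub>\<S>\<^esub> Q'"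
  by (simp add: UP_def PS_def)

lemma up_add_PS:
  "Q \<in> carrier (UP \<R>) \<Longrightarrow> Q' \<in> carrier (UP \<R>) \<Longrightarrow> Q \<oplus>\<^bsub>UP \<R>\<^esub> Q' = Q \<oplus>\<^bsub>\<S>\<^esub> Q'"
  by (simp add: UP_def PS_def)

lemma up_one_PS: "\<one>\<^bsub>UP \<R>\<^esub> = \<one>\<^bsub>\<S>\<^esub>" and up_zero_PS: "\<zero>\<^bsub>UP \<R>\<^esub> = \<zero>\<^bsub>\<S>\<^esub>"
  by (simp_all add: UP_def PS_def)

lemma up_coeff: "Q \<in> carrier (UP \<R>) \<Longrightarrow> UnivPoly.coeff (UP \<R>) Q i = Q i"
  by (simp add: UP_def)

end

context prime_residue_field
begin

text \<open>The multiples of p^a are the kernel of the reduction to R/(p^a). Writing x at level n +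
  a as p^a c_n and cancelling p^a, at the cost of a levels, gives a coherent sequence c_n.\<close>

lemma completion_dvd_power_iff:
  assumes x: "x \<in> carrier \<R>"
  shows "(\<exists>c\<in>carrier \<R>. x = \<iota> (p ^ a) \<otimes>\<^bsub>\<R>\<^esub> c) \<longleftrightarrow> x a = pi_coset p a 0"
proof
  assume "\<exists>c\<in>carrier \<R>. x = \<iota> (p ^ a) \<otimes>\<^bsub>\<R>\<^esub> c"
  then obtain c where c: "c \<in> carrier \<R>" "x = \<iota> (p ^ a) \<otimes>\<^bsub>\<R>\<^esub> c" by blast
  obtain r where "c a = pi_coset p a r" using completion_rep[OF c(1)] by blast
  then have "x a = pi_coset p a (p ^ a * r)"
    unfolding c(2) by (intro completion_mult_nth completion_map_nth)
  also have "\<dots> = pi_coset p a 0" by (simp add: pi_coset_eq_iff)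
  finally show "x a = pi_coset p a 0" .
next
  assume x0: "x a = pi_coset p a 0"
  have "\<exists>c. x (n + a) = pi_coset p (n + a) (p ^ a * c)" for n
  proof -
    obtain r where r: "x (n + a) = pi_coset p (n + a) r" using completion_rep[OF x] by blast
    then have "x a = pi_coset p a r" by (rule completion_rep_le[OF x]) simp
    then have "p ^ a dvd r" using x0 by (simp add: pi_coset_eq_iff)
    then show ?thesis using r by (auto elim: dvdE)
  qed
  then obtain c where c: "\<And>n. x (n + a) = pi_coset p (n + a) (p ^ a * c n)" by metis
  have "(\<lambda>n. pi_coset p n (c n)) \<in> carrier \<R>"
    unfolding completion_carrier_iff
  proof (intro exI allI conjI)
    fix n
    have "x (n + a) = pi_coset p (n + a) (p ^ a * c (Suc n))"
      by (rule completion_rep_le[OF x c]) simp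
    then have "p ^ a * p ^ n dvd p ^ a * (c (Suc n) - c n)"
      using c[of n] by (simp add: pi_coset_eq_iff power_add ac_simps right_diff_distrib)
    then show "p ^ n dvd c (Suc n) - c n" by simp
  qed simp
  moreover have "x = \<iota> (p ^ a) \<otimes>\<^bsub>\<R>\<^esub> (\<lambda>n. pi_coset p n (c n))"
  proof (rule ext)
    fix n
    have "x n = pi_coset p n (p ^ a * c n)"
      by (rule completion_rep_le[OF x c]) simp
    also have "\<dots> = (\<iota> (p ^ a) \<otimes>\<^bsub>\<R>\<^esub> (\<lambda>n. pi_coset p n (c n))) n"
      by (rule completion_mult_nth[symmetric]) (simp_all add: completion_map_nth)
    finally show "x n = (\<iota> (p ^ a) \<otimes>\<^bsub>\<R>\<^esub> (\<lambda>n. pi_coset p n (c n))) n" .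
  qed
  ultimately show "\<exists>c\<in>carrier \<R>. x = \<iota> (p ^ a) \<otimes>\<^bsub>\<R>\<^esub> c" by blast
qed

end

subsection \<open>Units, divisibility and descent\<close>

context prime_residue_field
begin

text \<open>One factor p is cancelled from whichever of r and s it divides, lowering n or m
  accordingly.\<close>

lemma prime_power_dvd_mult:
  assumes "p ^ (n + m) dvd r * s"
  shows "p ^ n dvd r \<or> p ^ m dvd s"
  using assms
proof (induction "n + m" arbitrary: n m r s)
  case (Suc k)
  show ?case
  proof (cases "n = 0 \<or> m = 0")
    case False
    have dv: "p * p ^ k dvd r * s" using Suc.prems by (simp flip: Suc.hyps(2))
    then have "p dvd r * s" by (rule dvd_mult_left)
    then have "p dvd r \<or> p dvd s" using prime by (simp add: prime_elem_dvd_mult_iff)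
    then show ?thesis
    proof
      assume "p dvd r"
      then obtain r' where r': "r = p * r'" by (rule dvdE)
      then have "p ^ k dvd r' * s" using dv by (simp add: mult.assoc)
      moreover obtain n' where n': "n = Suc n'" using False not0_implies_Suc by blast
      ultimately have "p ^ n' dvd r' \<or> p ^ m dvd s" using Suc.hyps by simp
      then show ?thesis unfolding n' r' by (auto intro: mult_dvd_mono)
    next
      assume "p dvd s"
      then obtain s' where s': "s = p * s'" by (rule dvdE)
      then have "p ^ k dvd r * s'" using dv by (simp add: mult.left_commute)
      moreover obtain m' where m': "m = Suc m'" using False not0_implies_Suc by blast
      ultimately have "p ^ n dvd r \<or> p ^ m' dvd s'" using Suc.hyps by simp
      then show ?thesis unfolding m' s' by (auto intro: mult_dvd_mono)
    qed
  qed auto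
qed simp

text \<open>If x is nonzero at level n and y at level m, then their product is nonzero at level n +
  m.\<close>

lemma completion_domain: "domain \<R>"
proof (intro domain.intro domain_axioms.intro)
  show "cring \<R>" by (rule completion_cring)
  show "\<one>\<^bsub>\<R>\<^esub> \<noteq> \<zero>\<^bsub>\<R>\<^esub>"
  proof
    assume "\<one>\<^bsub>\<R>\<^esub> = \<zero>\<^bsub>\<R>\<^esub>"
    then have "\<one>\<^bsub>\<R>\<^esub> 1 = \<zero>\<^bsub>\<R>\<^esub> 1" by simp
    then have "p dvd 1" by (simp add: completion_nth pi_coset_eq_iff)
    with prime show False by (simp add: prime_elem_def)
  qed
  fix x y assume xy: "x \<otimes>\<^bsub>\<R>\<^esub> y = \<zero>\<^bsub>\<R>\<^esub>" and x: "x \<in> carrier \<R>" and y: "y \<in> carrier \<R>"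
  show "x = \<zero>\<^bsub>\<R>\<^esub> \<or> y = \<zero>\<^bsub>\<R>\<^esub>"
  proof (rule ccontr)
    assume "\<not> ?thesis"
    then obtain n m where nm: "x n \<noteq> pi_coset p n 0" "y m \<noteq> pi_coset p m 0"
      by (metis ext completion_zero_nth)
    obtain r s where r: "x (n + m) = pi_coset p (n + m) r" and s: "y (n + m) = pi_coset p (n + m) s"
      using completion_rep x y by metis
    have "pi_coset p (n + m) (r * s) = pi_coset p (n + m) 0"
      using completion_mult_nth[of x _ r y s, OF r s] by (simp add: xy completion_zero_nth)
    then have "p ^ (n + m) dvd r * s" by (simp add: pi_coset_eq_iff)
    then have "p ^ n dvd r \<or> p ^ m dvd s" by (rule prime_power_dvd_mult)
    moreover have "x n = pi_coset p n r" by (rule completion_rep_le[OF x r]) simp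
    moreover have "y m = pi_coset p m s" by (rule completion_rep_le[OF y s]) simp
    ultimately show False using nm by (simp add: pi_coset_eq_iff)
  qed
qed

sublocale U: UP_domain \<R> "UP \<R>"
  by (intro UP_domain.intro completion_domain) simp

text \<open>A representative r of x at level a differs from x by a multiple of p^a. This density of
  R yields remainders in R when dividing over the completion.\<close>

lemma completion_approx:
  assumes "x \<in> carrier \<R>"
  obtains r s where "s \<in> carrier \<R>" "x = \<iota> (p ^ a) \<otimes>\<^bsub>\<R>\<^esub> s \<oplus>\<^bsub>\<R>\<^esub> \<iota> r"
proof -
  obtain r where r: "x a = pi_coset p a r" using completion_rep[OF assms] by blast
  have "(x \<oplus>\<^bsub>\<R>\<^esub> \<iota> (- r)) a = pi_coset p a 0"
    using completion_add_nth[of x _ r "\<iota> (- r)" "- r", OF r completion_map_nth] by simp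
  then obtain s where s: "s \<in> carrier \<R>" "x \<oplus>\<^bsub>\<R>\<^esub> \<iota> (- r) = \<iota> (p ^ a) \<otimes>\<^bsub>\<R>\<^esub> s"
    using completion_dvd_power_iff[of "x \<oplus>\<^bsub>\<R>\<^esub> \<iota> (- r)" a] assms by auto
  have "\<iota> (- r) \<oplus>\<^bsub>\<R>\<^esub> \<iota> r = \<zero>\<^bsub>\<R>\<^esub>" by (simp flip: completion_map_add completion_map_zero)
  then have "x = (x \<oplus>\<^bsub>\<R>\<^esub> \<iota> (- r)) \<oplus>\<^bsub>\<R>\<^esub> \<iota> r" using assms by (simp add: R.a_assoc)
  with s that show ?thesis by metis
qed

lemma PS_mult_0: "F \<in> carrier \<S> \<Longrightarrow> G \<in> carrier \<S> \<Longrightarrow> (F \<otimes>\<^bsub>\<S>\<^esub> G) 0 = F 0 \<otimes>\<^bsub>\<R>\<^esub> G 0"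
  by (simp add: PS_mult PS_carrier)

lemma completion_Units_not_dvd:
  assumes "x \<in> Units \<R>" "x 1 = pi_coset p 1 r"
  shows "\<not> p dvd r"
proof
  assume "p dvd r"
  obtain y where y: "y \<in> carrier \<R>" "x \<otimes>\<^bsub>\<R>\<^esub> y = \<one>\<^bsub>\<R>\<^esub>" using assms(1) by (auto simp: Units_def)
  obtain s where s: "y 1 = pi_coset p 1 s" using completion_rep[OF y(1)] by blast
  have "pi_coset p 1 (r * s) = pi_coset p 1 1"
    using completion_mult_nth[of x _ r y s, OF assms(2) s] by (simp add: y completion_one_nth)
  then have "p dvd r * s - 1" by (simp add: pi_coset_eq_iff)
  moreover have "p dvd r * s" using \<open>p dvd r\<close> by simp
  ultimately have "p dvd r * s - (r * s - 1)" by (rule dvd_diff[rotated])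
  then have "p dvd 1" by simp
  with prime show False by (simp add: prime_elem_def)
qed

lemma PS_Units_0:
  assumes "F \<in> Units \<S>" shows "F 0 \<in> Units \<R>"
proof -
  obtain G where G: "F \<in> carrier \<S>" "G \<in> carrier \<S>" "F \<otimes>\<^bsub>\<S>\<^esub> G = \<one>\<^bsub>\<S>\<^esub>" "G \<otimes>\<^bsub>\<S>\<^esub> F = \<one>\<^bsub>\<S>\<^esub>"
    using assms by (auto simp: Units_def)
  then have "F 0 \<otimes>\<^bsub>\<R>\<^esub> G 0 = \<one>\<^bsub>\<R>\<^esub>" "G 0 \<otimes>\<^bsub>\<R>\<^esub> F 0 = \<one>\<^bsub>\<R>\<^esub>"
    using PS_mult_0 by (metis PS_one)+
  with G show ?thesis by (auto simp: Units_def PS_carrier)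
qed

text \<open>Lifts of F have inverses modulo p^n, unique modulo p^n, so these glue to an inverse of
  F.\<close>

lemma PS_Units_mod:
  assumes F: "F \<in> carrier \<S>" and G: "represents 1 F G" "\<not> p dvd fps_nth G 0"
  shows "F \<in> Units \<S>"
proof -
  define Q where "Q n H \<longleftrightarrow> (\<exists>G. represents n F G \<and> fps_const (p ^ n) dvd G * H - 1)" for n H
  obtain V where V: "V \<in> carrier \<S>" "\<And>n. \<exists>H. Q n H \<and> represents n V H"
  proof (rule represents_lift_unique)
    fix n
    \<comment> \<open>Level \<open>Suc n\<close> instead of \<open>n\<close>, so that the lift can
      be compared with \<open>G\<close> modulo p even for n = 0.\<close>
    obtain G' where G': "represents (Suc n) F G'" using represents_ex[OF F] by blast
    then have "represents 1 F G'" by (rule represents_le[OF F]) simp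
    then have "fps_const (p ^ 1) dvd G - G'" using G(1) by (rule represents_dvd[rotated])
    then have "p dvd fps_nth G 0 - fps_nth G' 0" by (auto simp: fps_const_dvd_iff)
    then have "\<not> p dvd fps_nth G' 0" using G(2) by (metis diff_add_cancel dvd_add)
    then obtain H where "fps_const (p ^ n) dvd G' * H - 1" using fps_inverse_mod_power by blast
    moreover have "represents n F G'" by (rule represents_le[OF F G']) simp
    ultimately show "\<exists>H. Q n H" unfolding Q_def by blast
  next
    fix n H assume "Q (Suc n) H"
    moreover have "fps_const (p ^ n) dvd fps_const (p ^ Suc n)" by (simp add: fps_const_dvd_iff)
    ultimately show "Q n H" unfolding Q_def using represents_le[OF F] by (meson dvd_trans le_SucI order_refl)
  next
    fix n H H' assume "Q n H" "Q n H'"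
    then obtain A B where A: "represents n F A" "fps_const (p ^ n) dvd A * H - 1"
      and B: "represents n F B" "fps_const (p ^ n) dvd B * H' - 1" unfolding Q_def by blast
    \<comment> \<open>Uniqueness of inverses, corrected for the two possibly different lifts
      \<open>A\<close> and \<open>B\<close> of \<open>F\<close>.\<close>
    have "H - H' = (A * H - 1) * H' - (B * H' - 1) * H - (A - B) * (H * H')"
      by (simp add: algebra_simps)
    then show "fps_const (p ^ n) dvd H - H'"
      using A B represents_dvd[OF A(1) B(1)] by (metis dvd_diff dvd_mult2)
  qed blast
  have "F \<otimes>\<^bsub>\<S>\<^esub> V = \<one>\<^bsub>\<S>\<^esub>"
  proof (rule represents_eqI)
    fix n
    obtain H A where "represents n V H" "represents n F A" and A: "fps_const (p ^ n) dvd A * H - 1"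
      using V(2)[of n] by (auto simp: Q_def)
    then have "represents n (F \<otimes>\<^bsub>\<S>\<^esub> V) (A * H)" by (intro represents_mult F V)
    with A have "represents n (F \<otimes>\<^bsub>\<S>\<^esub> V) 1" using represents_iff by blast
    then show "\<exists>G. represents n (F \<otimes>\<^bsub>\<S>\<^esub> V) G \<and> represents n \<one>\<^bsub>\<S>\<^esub> G"
      using represents_one by blast
  qed
  with F V(1) show ?thesis by (rule PS_UnitsI)
qed

lemma PS_Units_iff:
  assumes "F \<in> carrier \<S>" shows "F \<in> Units \<S> \<longleftrightarrow> F 0 \<in> Units \<R>"
proof
  assume "F 0 \<in> Units \<R>"
  obtain G where G: "represents 1 F G" using represents_ex[OF assms] by blast
  then have "\<not> p dvd fps_nth G 0"
    using \<open>F 0 \<in> Units \<R>\<close> completion_Units_not_dvd by (simp add: represents_def)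
  with assms G show "F \<in> Units \<S>" by (rule PS_Units_mod)
qed (rule PS_Units_0)

lemma completion_dvd_p_iff:
  assumes "x \<in> carrier \<R>"
  shows "(\<exists>c\<in>carrier \<R>. x = \<iota> p \<otimes>\<^bsub>\<R>\<^esub> c) \<longleftrightarrow> x 1 = pi_coset p 1 0"
  using completion_dvd_power_iff[OF assms, of 1] by simp

lemma completion_p_nonzero: "\<iota> p \<noteq> \<zero>\<^bsub>\<R>\<^esub>"
proof
  assume "\<iota> p = \<zero>\<^bsub>\<R>\<^esub>"
  \<comment> \<open>Level 2 is the first at which the image of p is nonzero.\<close>
  then have "\<iota> p 2 = \<zero>\<^bsub>\<R>\<^esub> 2" by simp
  then have "p * p dvd p * 1" by (simp add: completion_nth pi_coset_eq_iff power2_eq_square)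
  then have "p dvd 1" unfolding dvd_mult_cancel_left by simp
  with prime show False by (simp add: prime_elem_def)
qed

text \<open>Up to units, the divisors of p^m are powers of p and so come from R. Modulo p one of x
  and y vanishes and gives up a factor p; only a factor taken from x counts towards a.\<close>

lemma completion_divisor_primepow:
  assumes "x \<in> carrier \<R>" "y \<in> carrier \<R>" "x \<otimes>\<^bsub>\<R>\<^esub> y = \<iota> (p ^ m)"
  shows "\<exists>a. \<exists>v\<in>Units \<R>. x \<otimes>\<^bsub>\<R>\<^esub> v = \<iota> (p ^ a)"
  using assms
proof (induction m arbitrary: x y)
  case 0
  then have "x \<otimes>\<^bsub>\<R>\<^esub> y = \<one>\<^bsub>\<R>\<^esub>" by (simp add: completion_map_one)
  with 0 have "y \<in> Units \<R>" using R.m_comm[of x y] by (auto simp: Units_def)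
  with 0 show ?case by blast
next
  case (Suc m)
  have cancel: "u \<otimes>\<^bsub>\<R>\<^esub> w = \<iota> (p ^ m)"
    if "u \<in> carrier \<R>" "w \<in> carrier \<R>" "\<iota> p \<otimes>\<^bsub>\<R>\<^esub> (u \<otimes>\<^bsub>\<R>\<^esub> w) = \<iota> (p ^ Suc m)" for u w
  proof -
    have "\<iota> p \<otimes>\<^bsub>\<R>\<^esub> (u \<otimes>\<^bsub>\<R>\<^esub> w) = \<iota> p \<otimes>\<^bsub>\<R>\<^esub> \<iota> (p ^ m)"
      using that(3) by (simp add: completion_map_mult)
    then show ?thesis using that U.R.m_lcancel[OF completion_p_nonzero] by simp
  qed
  obtain r s where r: "x 1 = pi_coset p 1 r" and s: "y 1 = pi_coset p 1 s"
    using completion_rep Suc.prems by metis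
  have "pi_coset p 1 (r * s) = pi_coset p 1 (p ^ Suc m)"
    using completion_mult_nth[of x _ r y s, OF r s] by (simp only: Suc.prems completion_map_nth)
  then have "p dvd r * s - p * p ^ m" by (simp add: pi_coset_eq_iff)
  then have "p dvd r * s" by (metis diff_add_cancel dvd_add dvd_triv_left)
  then have "p dvd r \<or> p dvd s" using prime by (simp add: prime_elem_dvd_mult_iff)
  then show ?case
  proof
    assume "p dvd r"
    then have "x 1 = pi_coset p 1 0" by (simp add: r pi_coset_eq_iff del: One_nat_def)
    then obtain c where c: "c \<in> carrier \<R>" "x = \<iota> p \<otimes>\<^bsub>\<R>\<^esub> c"
      using completion_dvd_p_iff Suc.prems(1) by blast
    have "c \<otimes>\<^bsub>\<R>\<^esub> y = \<iota> (p ^ m)"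
      using Suc.prems c by (intro cancel) (simp_all add: R.m_assoc)
    from Suc.IH[OF c(1) Suc.prems(2) this] obtain a v where
      v: "v \<in> Units \<R>" "c \<otimes>\<^bsub>\<R>\<^esub> v = \<iota> (p ^ a)" by blast
    then have "x \<otimes>\<^bsub>\<R>\<^esub> v = \<iota> (p ^ Suc a)"
      using c R.Units_closed[OF v(1)] by (simp add: R.m_assoc completion_map_mult)
    with v(1) show ?case by blast
  next
    assume "p dvd s"
    then have "y 1 = pi_coset p 1 0" by (simp add: s pi_coset_eq_iff del: One_nat_def)
    then obtain c where c: "c \<in> carrier \<R>" "y = \<iota> p \<otimes>\<^bsub>\<R>\<^esub> c"
      using completion_dvd_p_iff Suc.prems(2) by blast
    have "x \<otimes>\<^bsub>\<R>\<^esub> c = \<iota> (p ^ m)"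
      using Suc.prems c by (intro cancel) (simp_all add: R.m_lcomm)
    from Suc.IH[OF Suc.prems(1) c(1) this] show ?case .
  qed
qed

text \<open>Division by A with a remainder over R. Coefficient n requires F_n = A_0 V_n + T_n + r_n,
  where T_n involves only earlier V_i. This is solvable because F_n - T_n lies in R up to a multiple
  of p^a, hence of A_0. The constant coefficients are prescribed from outside, so that V can be
  forced to be a unit.\<close>

lemma PS_decompose:
  assumes A: "A \<in> carrier \<S>" and F: "F \<in> carrier \<S>"
    and y: "y \<in> carrier \<R>" "A 0 \<otimes>\<^bsub>\<R>\<^esub> y = \<iota> (p ^ a)"
    and v: "v \<in> carrier \<R>" "F 0 = A 0 \<otimes>\<^bsub>\<R>\<^esub> v \<oplus>\<^bsub>\<R>\<^esub> \<iota> r0"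
  obtains V G where "V \<in> carrier \<S>" "V 0 = v" "fps_nth G 0 = r0" "F = A \<otimes>\<^bsub>\<S>\<^esub> V \<oplus>\<^bsub>\<S>\<^esub> \<phi> G"
proof -
  have A': "A i \<in> carrier \<R>" and F': "F i \<in> carrier \<R>" for i using A F by (simp_all add: PS_carrier)
  define T where "T V n = (\<Oplus>\<^bsub>\<R>\<^esub>j\<in>{1..n}. A j \<otimes>\<^bsub>\<R>\<^esub> V (n - j))" for V :: "nat \<Rightarrow> nat \<Rightarrow> 'a set" and n
  \<comment> \<open>The guard drops the equation if an earlier coefficient lies outside the carrier.
    This ensures that \<open>P V n\<close> depends only on the values of \<open>V\<close> below
    \<open>n\<close>.\<close>
  define P where "P V n x \<longleftrightarrow> x \<in> carrier \<R> \<and> (n = 0 \<longrightarrow> x = v) \<and>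
      ((\<forall>i<n. V i \<in> carrier \<R>) \<longrightarrow> (\<exists>r. (n = 0 \<longrightarrow> r = r0) \<and>
        F n = A 0 \<otimes>\<^bsub>\<R>\<^esub> x \<oplus>\<^bsub>\<R>\<^esub> T V n \<oplus>\<^bsub>\<R>\<^esub> \<iota> r))" for V n x
  have T_closed: "T V n \<in> carrier \<R>" if "\<And>i. i < n \<Longrightarrow> V i \<in> carrier \<R>" for V n
    unfolding T_def using A' that by (intro R.finsum_closed) auto
  have "\<exists>V. \<forall>n. P V n (V n)"
  proof (rule dependent_wellorder_choice)
    fix V V' :: "nat \<Rightarrow> nat \<Rightarrow> 'a set" and n x
    assume eq: "\<And>i. i < n \<Longrightarrow> V i = V' i"
    show "P V n x = P V' n x"
    proof (cases "\<forall>i<n. V' i \<in> carrier \<R>")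
      case True
      have "T V n = T V' n"
        unfolding T_def using eq A' True by (intro R.finsum_cong') auto
      then show ?thesis using eq by (simp add: P_def)
    next
      case False
      then show ?thesis using eq by (auto simp: P_def)
    qed
  next
    fix n V assume V: "\<And>i. i < n \<Longrightarrow> P V i (V i)"
    then have V': "V i \<in> carrier \<R>" if "i < n" for i using that by (simp add: P_def)
    show "\<exists>x. P V n x"
    proof (cases "n = 0")
      case True
      have "F 0 = A 0 \<otimes>\<^bsub>\<R>\<^esub> v \<oplus>\<^bsub>\<R>\<^esub> T V 0 \<oplus>\<^bsub>\<R>\<^esub> \<iota> r0"
        using v A' by (simp add: T_def)
      then have "P V n v" using True v by (auto simp: P_def)
      then show ?thesis by blast
    next
      case False
      have Tc: "T V n \<in> carrier \<R>" using V' by (rule T_closed)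
      obtain r s where s: "s \<in> carrier \<R>" "F n \<ominus>\<^bsub>\<R>\<^esub> T V n = \<iota> (p ^ a) \<otimes>\<^bsub>\<R>\<^esub> s \<oplus>\<^bsub>\<R>\<^esub> \<iota> r"
        by (rule completion_approx[OF R.minus_closed[OF F' Tc]])
      \<comment> \<open>The new coefficient of V is the product of \<open>y\<close> and
        \<open>s\<close>, since \<open>A 0\<close> times \<open>y\<close> is p^a.\<close>
      have "A 0 \<otimes>\<^bsub>\<R>\<^esub> (y \<otimes>\<^bsub>\<R>\<^esub> s) = \<iota> (p ^ a) \<otimes>\<^bsub>\<R>\<^esub> s"
        using A' y s(1) by (simp flip: R.m_assoc)
      moreover have "F n = (F n \<ominus>\<^bsub>\<R>\<^esub> T V n) \<oplus>\<^bsub>\<R>\<^esub> T V n"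
        using F' Tc by (simp add: a_minus_def R.a_assoc R.l_neg)
      ultimately have "F n = A 0 \<otimes>\<^bsub>\<R>\<^esub> (y \<otimes>\<^bsub>\<R>\<^esub> s) \<oplus>\<^bsub>\<R>\<^esub> T V n \<oplus>\<^bsub>\<R>\<^esub> \<iota> r"
        using s A' F' Tc y by (simp add: R.a_ac)
      then have "P V n (y \<otimes>\<^bsub>\<R>\<^esub> s)" using False y s by (auto simp: P_def)
      then show ?thesis by blast
    qed
  qed
  then obtain V where V: "\<And>n. P V n (V n)" by blast
  then have V': "V i \<in> carrier \<R>" for i by (simp add: P_def)
  have "\<exists>r. (n = 0 \<longrightarrow> r = r0) \<and>
      F n = A 0 \<otimes>\<^bsub>\<R>\<^esub> V n \<oplus>\<^bsub>\<R>\<^esub> T V n \<oplus>\<^bsub>\<R>\<^esub> \<iota> r" for n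
    using V[of n] V' by (simp add: P_def)
  then obtain r where r0: "r 0 = r0"
    and r: "\<And>n. F n = A 0 \<otimes>\<^bsub>\<R>\<^esub> V n \<oplus>\<^bsub>\<R>\<^esub> T V n \<oplus>\<^bsub>\<R>\<^esub> \<iota> (r n)" by metis
  have "(A \<otimes>\<^bsub>\<S>\<^esub> V) n = A 0 \<otimes>\<^bsub>\<R>\<^esub> V n \<oplus>\<^bsub>\<R>\<^esub> T V n" for n
  proof -
    have "{..n} = insert 0 {1..n}" by auto
    then show ?thesis unfolding PS_mult T_def
      using A' V' by (simp add: R.finsum_insert Pi_def)
  qed
  then have "F = A \<otimes>\<^bsub>\<S>\<^esub> V \<oplus>\<^bsub>\<S>\<^esub> \<phi> (Abs_fps r)"
    by (intro ext) (simp add: PS_add fps_to_completion_def flip: r)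
  moreover have "V \<in> carrier \<S>" using V' by (simp add: PS_carrier)
  moreover have "V 0 = v" using V[of 0] by (simp add: P_def)
  moreover have "fps_nth (Abs_fps r) 0 = r0" by (simp add: r0)
  ultimately show ?thesis using that by blast
qed

text \<open>Lifts of V turn the equation into congruences modulo all powers of p, which suffice for
  divisibility over R.\<close>

lemma fps_dvd_of_dvd_completion:
  assumes "fps_nth f 0 dvd p ^ m" "V \<in> carrier \<S>" "\<phi> F = \<phi> f \<otimes>\<^bsub>\<S>\<^esub> V"
  shows "f dvd F"
proof (rule fps_dvd_of_dvd_mod_powers[OF assms(1)])
  fix n
  obtain G where G: "represents n V G" using represents_ex[OF assms(2)] by blast
  have "represents n (\<phi> F) (f * G)"
    unfolding assms(3) by (intro represents_mult represents_map G assms fps_map_closed)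
  then have "fps_const (p ^ n) dvd F - f * G" using represents_map represents_dvd by blast
  then show "\<exists>V. fps_const (p ^ n) dvd F - f * V" ..
qed

end

subsection \<open>Weierstrass preparation over the completion\<close>

context prime_residue_field
begin

text \<open>The degree is an explicit parameter; membership of the lower coefficients in the ideal
  generated by p is tested at level 1.\<close>

definition distinguished_poly :: "nat \<Rightarrow> (nat \<Rightarrow> nat \<Rightarrow> 'a set) \<Rightarrow> bool" where
  "distinguished_poly n P \<longleftrightarrow> P \<in> carrier (UP \<R>) \<and> P n = \<one>\<^bsub>\<R>\<^esub> \<and> (\<forall>i>n. P i = \<zero>\<^bsub>\<R>\<^esub>) \<and>
     (\<forall>i<n. P i 1 = pi_coset p 1 0)"

lemma distinguished_poly_closed:
  "distinguished_poly n P \<Longrightarrow> P \<in> carrier (UP \<R>)"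
  "distinguished_poly n P \<Longrightarrow> P \<in> carrier \<S>"
  by (auto simp: distinguished_poly_def intro: up_carrier_PS)

lemma distinguished_poly_mod:
  assumes "distinguished_poly n P" shows "represents 1 P (fps_X ^ n)"
  unfolding represents_def
proof
  fix i show "P i 1 = pi_coset p 1 (fps_nth (fps_X ^ n) i)"
    using assms by (cases i n rule: linorder_cases)
      (simp_all add: distinguished_poly_def fps_X_power_nth completion_nth del: One_nat_def)
qed

lemma distinguished_poly_deg:
  assumes "distinguished_poly n P" shows "deg \<R> P = n"
  using assms U.R.one_not_zero
  by (intro antisym U.deg_aboveI U.deg_belowI) (simp_all add: distinguished_poly_def up_coeff)

lemma distinguished_poly_one: "distinguished_poly 0 \<one>\<^bsub>\<S>\<^esub>"
  using U.P.one_closed by (auto simp: distinguished_poly_def up_one_PS PS_one)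

definition is_weierstrass_poly :: "'a fps \<Rightarrow> (nat \<Rightarrow> nat \<Rightarrow> 'a set) \<Rightarrow> bool" where
  "is_weierstrass_poly f P \<longleftrightarrow> (\<exists>n. distinguished_poly n P) \<and> (\<exists>U\<in>Units \<S>. \<phi> f = U \<otimes>\<^bsub>\<S>\<^esub> P)"

lemma is_weierstrass_poly_closed:
  assumes "is_weierstrass_poly f P"
  shows "P \<in> carrier (UP \<R>)" "P \<in> carrier \<S>"
  using assms distinguished_poly_closed by (auto simp: is_weierstrass_poly_def)

text \<open>The right-hand side is the description inside \<open>weierstrass_poly\<close>, so
  existence and uniqueness may be proved for \<open>is_weierstrass_poly\<close>.\<close>

lemma is_weierstrass_poly_iff:
  "is_weierstrass_poly f P \<longleftrightarrow> P \<in> carrier (UP \<R>) \<and>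
       UnivPoly.coeff (UP \<R>) P (deg \<R> P) = \<one>\<^bsub>\<R>\<^esub> \<and>
       (\<forall>i < deg \<R> P. UnivPoly.coeff (UP \<R>) P i \<in> {\<iota> p \<otimes>\<^bsub>\<R>\<^esub> c | c. c \<in> carrier \<R>}) \<and>
       (\<exists>U \<in> Units \<S>. \<phi> f = U \<otimes>\<^bsub>\<S>\<^esub> P)"
proof (cases "P \<in> carrier (UP \<R>)")
  case True
  have Pc: "P i \<in> carrier \<R>" for i using True up_carrier_PS by (simp add: PS_carrier)
  have mem: "P i \<in> {\<iota> p \<otimes>\<^bsub>\<R>\<^esub> c | c. c \<in> carrier \<R>} \<longleftrightarrow> P i 1 = pi_coset p 1 0" for i
    using completion_dvd_p_iff[OF Pc[of i]] by blast
  have above: "P i = \<zero>\<^bsub>\<R>\<^esub>" if "i > deg \<R> P" for i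
    using U.deg_aboveD[OF that True] by (simp only: up_coeff[OF True])
  have "(\<exists>n. distinguished_poly n P) \<longleftrightarrow> distinguished_poly (deg \<R> P) P"
    using distinguished_poly_deg by blast
  also have "\<dots> \<longleftrightarrow> UnivPoly.coeff (UP \<R>) P (deg \<R> P) = \<one>\<^bsub>\<R>\<^esub> \<and>
      (\<forall>i < deg \<R> P. UnivPoly.coeff (UP \<R>) P i \<in> {\<iota> p \<otimes>\<^bsub>\<R>\<^esub> c | c. c \<in> carrier \<R>})"
    unfolding distinguished_poly_def up_coeff[OF True] mem using True above by blast
  finally show ?thesis using True by (simp add: is_weierstrass_poly_def)
next
  case False
  then show ?thesis by (auto simp: is_weierstrass_poly_def distinguished_poly_def)
qed

text \<open>Modulo p, f becomes a unit times X^n, so its order is n. Hence f determines the degree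
  of its Weierstrass polynomial.\<close>

lemma distinguished_of_weierstrass:
  assumes P: "distinguished_poly n P" and U: "U \<in> Units \<S>" and f: "\<phi> f = U \<otimes>\<^bsub>\<S>\<^esub> P"
  shows "distinguished n f"
proof -
  have Uc: "U \<in> carrier \<S>" using U by (rule S.Units_closed)
  obtain G where G: "represents 1 U G" using represents_ex[OF Uc] by blast
  then have "\<not> p dvd fps_nth G 0"
    using PS_Units_0[OF U] completion_Units_not_dvd by (simp add: represents_def)
  have "represents 1 (\<phi> f) (G * fps_X ^ n)"
    unfolding f by (intro represents_mult Uc G distinguished_poly_mod P distinguished_poly_closed[OF P])
  then have "fps_const (p ^ 1) dvd f - G * fps_X ^ n"
    using represents_map represents_dvd by blast
  then have dv: "p dvd fps_nth f i - (if i < n then 0 else fps_nth G (i - n))" for i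
    by (auto simp: fps_const_dvd_iff fps_X_power_mult_right_nth dest: spec[of _ i])
  have "p dvd fps_nth f i" if "i < n" for i using dv[of i] that by simp
  moreover have "\<not> p dvd fps_nth f n"
  proof
    assume "p dvd fps_nth f n"
    moreover have "p dvd fps_nth f n - fps_nth G 0" using dv[of n] by simp
    ultimately have "p dvd fps_nth f n - (fps_nth f n - fps_nth G 0)" by (rule dvd_diff)
    with \<open>\<not> p dvd fps_nth G 0\<close> show False by simp
  qed
  ultimately show ?thesis by (simp add: distinguished_def)
qed

lemma distinguished_unique: "distinguished n f \<Longrightarrow> distinguished m f \<Longrightarrow> n = m"
  unfolding distinguished_def by (metis linorder_cases)

lemma weierstrass_division_unique:
  assumes f: "distinguished d f" and q: "q \<in> carrier \<S>" and r: "r \<in> carrier \<S>" "\<forall>i\<ge>d. r i = \<zero>\<^bsub>\<R>\<^esub>"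
    and eq: "\<phi> f \<otimes>\<^bsub>\<S>\<^esub> q \<oplus>\<^bsub>\<S>\<^esub> r = \<zero>\<^bsub>\<S>\<^esub>"
  shows "q = \<zero>\<^bsub>\<S>\<^esub> \<and> r = \<zero>\<^bsub>\<S>\<^esub>"
proof -
  have "represents n q 0 \<and> represents n r 0" for n
  proof -
    obtain Q R where Q: "represents n q Q" and R: "represents n r R" using represents_ex q r(1) by metis
    \<comment> \<open>The coefficients of \<open>R\<close> from d on are merely divisible by p^n;
      they are cut off because division modulo p^n asks for exact zeros.\<close>
    have R': "represents n r (fps_cutoff d R)"
      unfolding represents_def
    proof
      fix i show "r i n = pi_coset p n (fps_nth (fps_cutoff d R) i)"
      proof (cases "i < d")
        case True then show ?thesis using R by (simp add: represents_def)
      next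
        case False then show ?thesis using r(2) by (simp add: completion_nth)
      qed
    qed
    have "represents n (\<phi> f \<otimes>\<^bsub>\<S>\<^esub> q \<oplus>\<^bsub>\<S>\<^esub> r) (f * Q + fps_cutoff d R)"
      by (intro represents_add represents_mult represents_map fps_map_closed q Q R')
    then have "fps_const (p ^ n) dvd f * Q + fps_cutoff d R - 0"
      unfolding eq using represents_zero represents_dvd by blast
    then have "fps_const (p ^ n) dvd Q \<and> fps_const (p ^ n) dvd fps_cutoff d R"
      by (intro weierstrass_division_unique_mod[OF f]) auto
    then show ?thesis using represents_iff[OF Q, of 0] represents_iff[OF R', of 0] by simp
  qed
  then show ?thesis using represents_zero represents_eqI by meson
qed

text \<open>Only the quotients modulo p^n are glued, so \<open>D\<close> leaves the remainder
  existential. The remainder is recovered afterwards as g - f q.\<close>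

lemma weierstrass_division:
  assumes f: "distinguished d f" and g: "g \<in> carrier \<S>"
  obtains q r where "q \<in> carrier \<S>" "r \<in> carrier \<S>" "\<forall>i\<ge>d. r i = \<zero>\<^bsub>\<R>\<^esub>"
    "g = \<phi> f \<otimes>\<^bsub>\<S>\<^esub> q \<oplus>\<^bsub>\<S>\<^esub> r"
proof -
  define D where "D n q \<longleftrightarrow> (\<exists>r G. represents n g G \<and> (\<forall>i\<ge>d. fps_nth r i = 0) \<and>
      fps_const (p ^ n) dvd G - (f * q + r))" for n q
  obtain q where q: "q \<in> carrier \<S>" "\<And>n. \<exists>Q. D n Q \<and> represents n q Q"
  proof (rule represents_lift_unique)
    fix n show "\<exists>q. D n q"
      unfolding D_def using represents_ex[OF g, of n] weierstrass_division_mod[OF f, of n] by metis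
  next
    fix n q assume "D (Suc n) q"
    moreover have "fps_const (p ^ n) dvd fps_const (p ^ Suc n)" by (simp add: fps_const_dvd_iff)
    ultimately show "D n q"
      unfolding D_def using represents_le[OF g] by (meson dvd_trans le_SucI order_refl)
  next
    fix n q q' assume "D n q" "D n q'"
    then obtain r r' G G' where r: "\<forall>i\<ge>d. fps_nth r i = 0" "\<forall>i\<ge>d. fps_nth r' i = 0"
      and G: "represents n g G" "represents n g G'"
      and dv: "fps_const (p ^ n) dvd G - (f * q + r)" "fps_const (p ^ n) dvd G' - (f * q' + r')"
      unfolding D_def by metis
    have "f * (q - q') + (r - r') = (G - G') - ((G - (f * q + r)) - (G' - (f * q' + r')))"
      by (simp add: algebra_simps)
    then have "fps_const (p ^ n) dvd f * (q - q') + (r - r')"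
      using dv represents_dvd[OF G] by (simp only: dvd_diff)
    then show "fps_const (p ^ n) dvd q - q'"
      using weierstrass_division_unique_mod[OF f] r by (metis diff_self fps_sub_nth)
  qed blast
  have fq: "\<phi> f \<otimes>\<^bsub>\<S>\<^esub> q \<in> carrier \<S>" using q by simp
  define r where "r = g \<ominus>\<^bsub>\<S>\<^esub> \<phi> f \<otimes>\<^bsub>\<S>\<^esub> q"
  have "r i = \<zero>\<^bsub>\<R>\<^esub>" if "i \<ge> d" for i
  proof (rule ext)
    fix n
    obtain Q s G where Q: "represents n q Q" and s: "\<forall>i\<ge>d. fps_nth s i = 0" and G: "represents n g G"
      and dv: "fps_const (p ^ n) dvd G - (f * Q + s)"
      using q(2)[of n] unfolding D_def by metis
    have "represents n r (G - f * Q)"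
      unfolding r_def by (intro represents_minus represents_mult g fq G q represents_map fps_map_closed Q)
    moreover have "fps_const (p ^ n) dvd (G - f * Q) - s" using dv by (simp add: algebra_simps)
    ultimately have "represents n r s" using represents_iff by blast
    then show "r i n = \<zero>\<^bsub>\<R>\<^esub> n" using s that by (simp add: represents_def completion_nth)
  qed
  moreover have "g = \<phi> f \<otimes>\<^bsub>\<S>\<^esub> q \<oplus>\<^bsub>\<S>\<^esub> r"
    unfolding r_def using g fq by (simp add: a_minus_def S.a_lcomm S.r_neg)
  moreover have "r \<in> carrier \<S>" unfolding r_def using g fq by simp
  ultimately show ?thesis using q(1) that by blast
qed

text \<open>Divide X^d by f to get X^d = f q + r and put P = X^d - r = f q. Modulo p the remainder
  vanishes and q has nonzero constant term, so P is distinguished and q is a unit.\<close>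

lemma weierstrass_poly_exists:
  assumes f: "distinguished d f"
  obtains P where "distinguished_poly d P" "is_weierstrass_poly f P"
proof -
  obtain q r where q: "q \<in> carrier \<S>" and r: "r \<in> carrier \<S>" "\<forall>i\<ge>d. r i = \<zero>\<^bsub>\<R>\<^esub>"
    and eq: "\<phi> (fps_X ^ d) = \<phi> f \<otimes>\<^bsub>\<S>\<^esub> q \<oplus>\<^bsub>\<S>\<^esub> r"
    by (rule weierstrass_division[OF f fps_map_closed])
  obtain Q R where Q: "represents 1 q Q" and R: "represents 1 r R" using represents_ex q r(1) by metis
  obtain l where l: "f = fps_X ^ d * fps_shift d f + fps_const p * l"
    using distinguished_mod[OF f] .
  have "represents 1 (\<phi> (fps_X ^ d)) (f * Q + R)"
    unfolding eq by (intro represents_add represents_mult represents_map fps_map_closed q Q R)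
  then have "fps_const (p ^ 1) dvd (f * Q + R) - fps_X ^ d"
    using represents_map represents_dvd by blast
  then have "fps_const p dvd ((f * Q + R) - fps_X ^ d) - fps_const p * (l * Q)" by simp
  also have "((f * Q + R) - fps_X ^ d) - fps_const p * (l * Q)
      = (fps_X ^ d * fps_shift d f + fps_const p * l) * Q + R - fps_X ^ d - fps_const p * (l * Q)"
    using l by simp
  also have "\<dots> = fps_X ^ d * (fps_shift d f * Q - 1) + R" by (simp add: algebra_simps)
  finally have dv: "p dvd fps_nth (fps_X ^ d * (fps_shift d f * Q - 1) + R) i" for i
    by (simp only: fps_const_dvd_iff)
  have R0: "p dvd fps_nth R i" if "i < d" for i
    using dv[of i] that by (simp add: fps_X_power_mult_nth)
  have "R' = pi_coset p 1 0 \<Longrightarrow> R' = pi_coset p 1 s \<Longrightarrow> p dvd s" for R' s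
    by (simp add: pi_coset_eq_iff del: One_nat_def)
  moreover have "r d 1 = pi_coset p 1 0" using r(2) by (simp add: completion_nth)
  ultimately have "p dvd fps_nth R d" using R unfolding represents_def by metis
  \<comment> \<open>Coefficient d of the relation \<open>dv\<close> is f_d Q_0 - 1 + R_d.\<close>
  with dv[of d] have "p dvd fps_nth f d * fps_nth Q 0 - 1"
    by (simp add: fps_X_power_mult_nth dvd_add_left_iff)
  have "\<not> p dvd fps_nth Q 0"
  proof
    assume "p dvd fps_nth Q 0"
    then have "p dvd fps_nth f d * fps_nth Q 0" by simp
    then have "p dvd fps_nth f d * fps_nth Q 0 - (fps_nth f d * fps_nth Q 0 - 1)"
      using \<open>p dvd fps_nth f d * fps_nth Q 0 - 1\<close> by (rule dvd_diff)
    then show False using prime by (simp add: prime_elem_def)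
  qed
  then have qU: "q \<in> Units \<S>" using PS_Units_mod[OF q Q] by simp
  define P where "P = \<phi> (fps_X ^ d) \<ominus>\<^bsub>\<S>\<^esub> r"
  have Pc: "P \<in> carrier \<S>" unfolding P_def using r by simp
  have P_eq: "P = \<phi> f \<otimes>\<^bsub>\<S>\<^esub> q"
    unfolding P_def eq using q r by (simp add: a_minus_def S.a_assoc S.r_neg)
  have "P \<oplus>\<^bsub>\<S>\<^esub> r = \<phi> (fps_X ^ d)" using eq P_eq by simp
  then have PrX: "P i \<oplus>\<^bsub>\<R>\<^esub> r i = \<iota> (if i = d then 1 else 0)" for i
    by (simp add: fps_to_completion_def fps_X_power_nth flip: PS_add)
  have ge: "P i = \<iota> (if i = d then 1 else 0)" if "i \<ge> d" for i
    using PrX[of i] r(2) that Pc by (simp add: PS_carrier)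
  have PU: "P \<in> carrier (UP \<R>)"
    by (rule up_carrierI[OF Pc, of d]) (use ge in \<open>simp add: completion_map_zero\<close>)
  have "represents 1 P (fps_X ^ d - R)"
    unfolding P_def by (intro represents_minus represents_map fps_map_closed r R)
  then have "P i 1 = pi_coset p 1 0" if "i < d" for i
    using R0[OF that] that by (simp add: represents_def fps_X_power_nth pi_coset_eq_iff)
  then have "distinguished_poly d P"
    using PU ge by (auto simp: distinguished_poly_def completion_map_one completion_map_zero)
  moreover have "is_weierstrass_poly f P"
    unfolding is_weierstrass_poly_def
  proof (intro conjI bexI exI)
    show "distinguished_poly d P" by fact
    show "inv\<^bsub>\<S>\<^esub> q \<in> Units \<S>" using qU by simp
    show "\<phi> f = inv\<^bsub>\<S>\<^esub> q \<otimes>\<^bsub>\<S>\<^esub> P"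
      unfolding P_eq using q qU by (simp add: S.m_lcomm)
  qed
  ultimately show ?thesis by (rule that)
qed

lemma is_weierstrass_poly_distinguished:
  assumes "is_weierstrass_poly f P"
  obtains d where "distinguished d f" "distinguished_poly d P"
  using assms distinguished_of_weierstrass unfolding is_weierstrass_poly_def by blast

lemma PS_Units_cancel:
  assumes "U \<in> Units \<S>" "P \<in> carrier \<S>"
  shows "U \<otimes>\<^bsub>\<S>\<^esub> P \<otimes>\<^bsub>\<S>\<^esub> inv\<^bsub>\<S>\<^esub> U = P"
  using assms by (simp add: S.m_comm[of U P] S.m_assoc S.Units_closed)

text \<open>P and P' are f times units and monic of the same degree d, so P' - P has degree below d.
  It is thus the remainder in a Weierstrass division of 0 by f.\<close>

lemma is_weierstrass_poly_unique:
  assumes P: "is_weierstrass_poly f P" and P': "is_weierstrass_poly f P'"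
  shows "P = P'"
proof -
  obtain d where d: "distinguished d f" "distinguished_poly d P"
    using is_weierstrass_poly_distinguished[OF P] .
  obtain d' where d': "distinguished d' f" "distinguished_poly d' P'"
    using is_weierstrass_poly_distinguished[OF P'] .
  have [simp]: "d' = d" using d'(1) d(1) by (rule distinguished_unique)
  have Pc: "P \<in> carrier \<S>" "P' \<in> carrier \<S>" using P P' is_weierstrass_poly_closed by auto
  obtain U U' where U: "U \<in> Units \<S>" "\<phi> f = U \<otimes>\<^bsub>\<S>\<^esub> P" and U': "U' \<in> Units \<S>" "\<phi> f = U' \<otimes>\<^bsub>\<S>\<^esub> P'"
    using P P' unfolding is_weierstrass_poly_def by blast
  have 1: "\<phi> f \<otimes>\<^bsub>\<S>\<^esub> inv\<^bsub>\<S>\<^esub> U = P" unfolding U(2) using U(1) Pc(1) by (rule PS_Units_cancel)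
  have 2: "\<phi> f \<otimes>\<^bsub>\<S>\<^esub> inv\<^bsub>\<S>\<^esub> U' = P'" unfolding U'(2) using U'(1) Pc(2) by (rule PS_Units_cancel)
  let ?q = "inv\<^bsub>\<S>\<^esub> U \<ominus>\<^bsub>\<S>\<^esub> inv\<^bsub>\<S>\<^esub> U'" and ?r = "P' \<ominus>\<^bsub>\<S>\<^esub> P"
  have "?q = \<zero>\<^bsub>\<S>\<^esub> \<and> ?r = \<zero>\<^bsub>\<S>\<^esub>"
  proof (rule weierstrass_division_unique[OF d(1)])
    show "?q \<in> carrier \<S>" using U(1) U'(1) by simp
    show "?r \<in> carrier \<S>" using Pc by simp
    have "?r \<oplus>\<^bsub>\<S>\<^esub> P = P'" using Pc by (simp add: a_minus_def S.a_assoc S.l_neg)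
    then have "?r i \<oplus>\<^bsub>\<R>\<^esub> P i = P' i" for i by (metis PS_add)
    moreover have "P i = P' i" if "i \<ge> d" for i
      using that d(2) d'(2) by (cases "i = d") (auto simp: distinguished_poly_def)
    moreover have "?r i \<in> carrier \<R>" "P i \<in> carrier \<R>" for i
      using \<open>?r \<in> carrier \<S>\<close> Pc by (auto simp: PS_carrier)
    ultimately show "\<forall>i\<ge>d. ?r i = \<zero>\<^bsub>\<R>\<^esub>"
      by (metis R.add.r_cancel_one')
    have "\<phi> f \<otimes>\<^bsub>\<S>\<^esub> ?q = P \<ominus>\<^bsub>\<S>\<^esub> P'"
      using U(1) U'(1) by (simp add: a_minus_def S.r_distr S.r_minus 1 2)
    then show "\<phi> f \<otimes>\<^bsub>\<S>\<^esub> ?q \<oplus>\<^bsub>\<S>\<^esub> ?r = \<zero>\<^bsub>\<S>\<^esub>"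
      using Pc by (simp add: a_minus_def S.a_assoc) (metis Pc S.a_assoc S.a_inv_closed S.l_neg S.l_zero S.r_neg)
  qed
  then show ?thesis using Pc by (metis S.r_right_minus_eq)
qed

lemma weierstrass_poly_eqI:
  assumes "is_weierstrass_poly f P" shows "weierstrass_poly p f = P"
  unfolding weierstrass_poly_def is_weierstrass_poly_iff[symmetric]
  using assms is_weierstrass_poly_unique by blast

lemma weierstrass_poly_works:
  assumes "\<not> fps_const p dvd f"
  shows "is_weierstrass_poly f (weierstrass_poly p f)"
  using distinguished_exists[OF assms] weierstrass_poly_exists weierstrass_poly_eqI by metis

end

subsection \<open>Irreducibility and the quotient ring\<close>

context prime_residue_field
begin

lemma up_Units_PS: "A \<in> Units (UP \<R>) \<Longrightarrow> A \<in> Units \<S>"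
  unfolding Units_def by (auto simp: up_mult_PS up_one_PS intro: up_carrier_PS)

lemma dvd_primepow_unit:
  assumes "x dvd p ^ m" "\<not> p dvd x" shows "x dvd 1"
proof -
  obtain y where "p dvd x * y - 1" using inverse_mod[OF assms(2)] by blast
  then obtain r s where "r * p ^ m + s * x = 1" using coprime_of_inverse_mod by blast
  moreover have "x dvd r * p ^ m + s * x" using assms(1) by simp
  ultimately show ?thesis by simp
qed

text \<open>Over the completion a unit has constant term prime to p, and a divisor of p^m that is
  prime to p is already a unit of R.\<close>

lemma fps_map_unit_iff:
  assumes "fps_nth f 0 dvd p ^ m"
  shows "\<phi> f \<in> Units \<S> \<longleftrightarrow> f dvd 1"
proof
  assume "\<phi> f \<in> Units \<S>"
  then have "\<iota> (fps_nth f 0) \<in> Units \<R>"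
    using PS_Units_0 by (force simp: fps_to_completion_def)
  then have "\<not> p dvd fps_nth f 0"
    using completion_Units_not_dvd completion_map_nth by blast
  with assms have "fps_nth f 0 dvd 1" by (rule dvd_primepow_unit)
  then show "f dvd 1" by (simp add: fps_is_unit_iff)
qed (rule fps_map_unit)

text \<open>If f is a unit, then the polynomial 1 meets the defining conditions and uniqueness gives
  P = 1.\<close>

lemma is_weierstrass_poly_Units:
  assumes P: "is_weierstrass_poly f P" and f0: "fps_nth f 0 dvd p ^ m"
  shows "P \<in> Units (UP \<R>) \<longleftrightarrow> f dvd 1"
proof
  obtain U where U: "U \<in> Units \<S>" "\<phi> f = U \<otimes>\<^bsub>\<S>\<^esub> P"
    using P unfolding is_weierstrass_poly_def by blast
  { assume "P \<in> Units (UP \<R>)"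
    then have "\<phi> f \<in> Units \<S>" unfolding U(2) using U(1) up_Units_PS by (intro S.Units_m_closed)
    then show "f dvd 1" using fps_map_unit_iff[OF f0] by simp }
  assume "f dvd 1"
  then have "\<phi> f \<in> Units \<S>" by (rule fps_map_unit)
  then have "is_weierstrass_poly f \<one>\<^bsub>\<S>\<^esub>"
    unfolding is_weierstrass_poly_def using distinguished_poly_one
    by (intro conjI exI[of _ 0] bexI[of _ "\<phi> f"]) simp_all
  then have "P = \<one>\<^bsub>UP \<R>\<^esub>" using P is_weierstrass_poly_unique by (simp add: up_one_PS)
  then show "P \<in> Units (UP \<R>)" by simp
qed

lemma PS_mult_top:
  assumes P: "P \<in> carrier \<S>" "\<And>i. i > n \<Longrightarrow> P i = \<zero>\<^bsub>\<R>\<^esub>"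
    and Q: "Q \<in> carrier \<S>" "\<And>i. i > m \<Longrightarrow> Q i = \<zero>\<^bsub>\<R>\<^esub>"
  shows "(P \<otimes>\<^bsub>\<S>\<^esub> Q) (n + m) = P n \<otimes>\<^bsub>\<R>\<^esub> Q m"
proof -
  have PQ: "P j \<in> carrier \<R>" "Q j \<in> carrier \<R>" for j using P Q by (auto simp: PS_carrier)
  have "(P \<otimes>\<^bsub>\<S>\<^esub> Q) (n + m) = (\<Oplus>\<^bsub>\<R>\<^esub>j\<in>{..n + m}. if n = j then P j \<otimes>\<^bsub>\<R>\<^esub> Q m else \<zero>\<^bsub>\<R>\<^esub>)"
    unfolding PS_mult
  proof (rule R.finsum_cong')
    fix j assume "j \<in> {..n + m}"
    consider "j < n" | "j = n" | "j > n" by linarith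
    then show "P j \<otimes>\<^bsub>\<R>\<^esub> Q (n + m - j) = (if n = j then P j \<otimes>\<^bsub>\<R>\<^esub> Q m else \<zero>\<^bsub>\<R>\<^esub>)"
      by cases (simp_all add: P(2) Q(2) PQ)
  qed (use PQ in auto)
  also have "\<dots> = P n \<otimes>\<^bsub>\<R>\<^esub> Q m" by (subst R.finsum_singleton) (use PQ in auto)
  finally show ?thesis .
qed

lemma distinguished_poly_mult:
  assumes P: "distinguished_poly n P" and Q: "distinguished_poly m Q"
  shows "distinguished_poly (n + m) (P \<otimes>\<^bsub>\<S>\<^esub> Q)"
proof -
  note Pc = distinguished_poly_closed[OF P] and Qc = distinguished_poly_closed[OF Q]
  have eq: "P \<otimes>\<^bsub>\<S>\<^esub> Q = P \<otimes>\<^bsub>UP \<R>\<^esub> Q" using Pc Qc by (simp add: up_mult_PS)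
  have closed: "P \<otimes>\<^bsub>\<S>\<^esub> Q \<in> carrier (UP \<R>)" unfolding eq using Pc Qc by simp
  have "(P \<otimes>\<^bsub>\<S>\<^esub> Q) (n + m) = P n \<otimes>\<^bsub>\<R>\<^esub> Q m"
    by (rule PS_mult_top) (use P Q Pc Qc in \<open>auto simp: distinguished_poly_def\<close>)
  then have top: "(P \<otimes>\<^bsub>\<S>\<^esub> Q) (n + m) = \<one>\<^bsub>\<R>\<^esub>" using P Q by (simp add: distinguished_poly_def)
  have "deg \<R> (P \<otimes>\<^bsub>\<S>\<^esub> Q) \<le> n + m"
    unfolding eq using U.deg_mult_ring[OF Pc(1) Qc(1)] P Q by (simp add: distinguished_poly_deg)
  then have above: "(P \<otimes>\<^bsub>\<S>\<^esub> Q) i = \<zero>\<^bsub>\<R>\<^esub>" if "i > n + m" for i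
    using U.deg_aboveD[OF _ closed, of i] that by (simp add: up_coeff[OF closed])
  have "represents 1 (P \<otimes>\<^bsub>\<S>\<^esub> Q) (fps_X ^ n * fps_X ^ m)"
    by (intro represents_mult Pc Qc distinguished_poly_mod P Q)
  then have "(P \<otimes>\<^bsub>\<S>\<^esub> Q) i 1 = pi_coset p 1 0" if "i < n + m" for i
    using that by (simp add: represents_def flip: power_add)
  with closed top above show ?thesis by (simp add: distinguished_poly_def)
qed

text \<open>With uniqueness this carries factorisations of f to factorisations of its Weierstrass
  polynomial.\<close>

lemma is_weierstrass_poly_mult:
  assumes P: "is_weierstrass_poly f P" and Q: "is_weierstrass_poly g Q"
  shows "is_weierstrass_poly (f * g) (P \<otimes>\<^bsub>\<S>\<^esub> Q)"
proof -
  note Pc = is_weierstrass_poly_closed[OF P] and Qc = is_weierstrass_poly_closed[OF Q]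
  obtain U where U: "U \<in> Units \<S>" "\<phi> f = U \<otimes>\<^bsub>\<S>\<^esub> P"
    using P unfolding is_weierstrass_poly_def by blast
  obtain V where V: "V \<in> Units \<S>" "\<phi> g = V \<otimes>\<^bsub>\<S>\<^esub> Q"
    using Q unfolding is_weierstrass_poly_def by blast
  have "\<phi> (f * g) = (U \<otimes>\<^bsub>\<S>\<^esub> V) \<otimes>\<^bsub>\<S>\<^esub> (P \<otimes>\<^bsub>\<S>\<^esub> Q)"
    using U V Pc Qc by (simp add: fps_map_mult S.m_ac S.Units_closed)
  moreover have "U \<otimes>\<^bsub>\<S>\<^esub> V \<in> Units \<S>" using U V by (intro S.Units_m_closed)
  ultimately show ?thesis
    using P Q distinguished_poly_mult unfolding is_weierstrass_poly_def by blast
qed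

text \<open>Factors of f inherit both hypotheses, so their Weierstrass polynomials exist and
  multiply to that of f. One of these is a unit, and then so is the corresponding factor.\<close>

lemma irreducible_fps_of_weierstrass:
  assumes f: "\<not> fps_const p dvd f" and f0: "fps_nth f 0 dvd p ^ m"
    and irr: "ring_irreducible\<^bsub>UP \<R>\<^esub> (weierstrass_poly p f)"
  shows "Factorial_Ring.irreducible f"
proof (rule Factorial_Ring.irreducibleI)
  note P = weierstrass_poly_works[OF f]
  note irrE = domain.ring_irreducibleE[OF U.UP_domain is_weierstrass_poly_closed(1)[OF P] irr]
  show "f \<noteq> 0" using f by auto
  show "\<not> f dvd 1" using irrE(4) is_weierstrass_poly_Units[OF P f0] by simp
  fix g h assume fgh: "f = g * h"
  have g: "\<not> fps_const p dvd g" and h: "\<not> fps_const p dvd h" using f fgh by auto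
  have g0: "fps_nth g 0 dvd p ^ m" and h0: "fps_nth h 0 dvd p ^ m"
    using f0 fgh by (auto dest: dvd_mult_left dvd_mult_right)
  note G = weierstrass_poly_works[OF g] and H = weierstrass_poly_works[OF h]
  note Gc = is_weierstrass_poly_closed(1)[OF G] and Hc = is_weierstrass_poly_closed(1)[OF H]
  have "weierstrass_poly p f = weierstrass_poly p g \<otimes>\<^bsub>UP \<R>\<^esub> weierstrass_poly p h"
    using weierstrass_poly_eqI[OF is_weierstrass_poly_mult[OF G H]] Gc Hc
    by (simp add: up_mult_PS flip: fgh)
  then show "g dvd 1 \<or> h dvd 1"
    using irrE(5)[OF Gc Hc] is_weierstrass_poly_Units[OF G g0] is_weierstrass_poly_Units[OF H h0] by blast
qed

text \<open>Zero is decomposed along A with V_0 = v a unit and remainder G with constant term -p^a,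
  which is consistent as A_0 v = p^a. Then V is a unit and A V = -G has coefficients in R.\<close>

lemma completion_divisor_descends:
  assumes A: "A \<in> carrier \<S>" and y: "y \<in> carrier \<R>" "A 0 \<otimes>\<^bsub>\<R>\<^esub> y = \<iota> (p ^ m)"
  obtains V g a where "V \<in> Units \<S>" "A \<otimes>\<^bsub>\<S>\<^esub> V = \<phi> g" "fps_nth g 0 = p ^ a"
proof -
  have "A 0 \<in> carrier \<R>" using A by (simp add: PS_carrier)
  then obtain a v where v: "v \<in> Units \<R>" "A 0 \<otimes>\<^bsub>\<R>\<^esub> v = \<iota> (p ^ a)"
    using completion_divisor_primepow y by blast
  have neg: "\<iota> (p ^ a) \<oplus>\<^bsub>\<R>\<^esub> \<iota> (- (p ^ a)) = \<zero>\<^bsub>\<R>\<^esub>"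
    by (simp flip: completion_map_add completion_map_zero)
  obtain V G where V: "V \<in> carrier \<S>" "V 0 = v" and G: "fps_nth G 0 = - (p ^ a)"
    and eq: "\<zero>\<^bsub>\<S>\<^esub> = A \<otimes>\<^bsub>\<S>\<^esub> V \<oplus>\<^bsub>\<S>\<^esub> \<phi> G"
    by (rule PS_decompose[OF A S.zero_closed R.Units_closed[OF v(1)] v(2) R.Units_closed[OF v(1)],
          of "- (p ^ a)"]) (use v(2) neg in \<open>simp add: PS_zero\<close>)
  have "\<phi> G \<oplus>\<^bsub>\<S>\<^esub> \<phi> (- G) = \<zero>\<^bsub>\<S>\<^esub>"
    unfolding fps_map_add[symmetric] by (rule represents_eqI) (use represents_map represents_zero in force)
  then have "A \<otimes>\<^bsub>\<S>\<^esub> V = (A \<otimes>\<^bsub>\<S>\<^esub> V \<oplus>\<^bsub>\<S>\<^esub> \<phi> G) \<oplus>\<^bsub>\<S>\<^esub> \<phi> (- G)"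
    using A V(1) by (simp add: S.a_assoc)
  then have "A \<otimes>\<^bsub>\<S>\<^esub> V = \<phi> (- G)" by (simp flip: eq)
  moreover have "V \<in> Units \<S>" using PS_Units_iff[OF V(1)] v(1) V(2) by simp
  moreover have "fps_nth (- G) 0 = p ^ a" using G by simp
  ultimately show ?thesis using that by blast
qed

text \<open>Let P = A B. Modulo p, B = A^(-1) P is a multiple of X^n, but its leading coefficient is
  a unit because the leading coefficients multiply to 1. So B has degree at least n, and A is a
  constant, namely a unit.\<close>

lemma distinguished_factor_Units:
  assumes A: "A \<in> carrier (UP \<R>)" "A \<in> Units \<S>" and B: "B \<in> carrier (UP \<R>)"
    and P: "distinguished_poly n (A \<otimes>\<^bsub>UP \<R>\<^esub> B)"
  shows "A \<in> Units (UP \<R>)"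
proof -
  note Ac = up_carrier_PS[OF A(1)] and Bc = up_carrier_PS[OF B]
  let ?P = "A \<otimes>\<^bsub>UP \<R>\<^esub> B"
  have "?P \<noteq> \<zero>\<^bsub>UP \<R>\<^esub>"
    using P U.R.one_not_zero by (auto simp: distinguished_poly_def up_zero_PS PS_zero)
  then have nz: "A \<noteq> \<zero>\<^bsub>UP \<R>\<^esub>" "B \<noteq> \<zero>\<^bsub>UP \<R>\<^esub>" using A(1) B by auto
  have deg: "n = deg \<R> A + deg \<R> B"
    using U.deg_mult[OF nz A(1) B] distinguished_poly_deg[OF P] by simp
  have BP: "B = inv\<^bsub>\<S>\<^esub> A \<otimes>\<^bsub>\<S>\<^esub> ?P"
    using A B Ac Bc by (simp add: up_mult_PS flip: S.m_assoc)
  obtain G where G: "represents 1 (inv\<^bsub>\<S>\<^esub> A) G"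
    using represents_ex A(2) S.Units_inv_closed by blast
  have Bmod: "represents 1 B (G * fps_X ^ n)"
    by (subst BP) (intro represents_mult G distinguished_poly_mod P distinguished_poly_closed[OF P]
        S.Units_inv_closed A)
  let ?e = "deg \<R> B"
  have "?P n = A (deg \<R> A) \<otimes>\<^bsub>\<R>\<^esub> B ?e"
    unfolding deg up_mult_PS[OF A(1) B]
    by (rule PS_mult_top[OF Ac _ Bc])
      (use U.deg_aboveD[OF _ A(1)] U.deg_aboveD[OF _ B] in \<open>simp_all add: up_coeff A B\<close>)
  then have "B ?e \<in> Units \<R>"
    using P Ac Bc by (auto simp: distinguished_poly_def PS_carrier Units_def R.m_comm)
  then have "\<not> ?e < n"
    using completion_Units_not_dvd[of "B ?e" 0] Bmod by (auto simp: represents_def fps_X_power_mult_right_nth)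
  with deg have "deg \<R> A = 0" by simp
  then have Am: "A = UnivPoly.monom (UP \<R>) (A 0) 0"
    using U.deg_zero_impl_monom[OF A(1)] by (simp add: up_coeff[OF A(1)])
  have A0: "A 0 \<in> Units \<R>" using A(2) by (rule PS_Units_0)
  let ?C = "UnivPoly.monom (UP \<R>) (inv\<^bsub>\<R>\<^esub> (A 0)) 0"
  have "A \<otimes>\<^bsub>UP \<R>\<^esub> ?C = UnivPoly.monom (UP \<R>) (A 0 \<otimes>\<^bsub>\<R>\<^esub> inv\<^bsub>\<R>\<^esub> (A 0)) (0 + 0)"
    using A0 by (subst Am) (simp only: U.monom_mult R.Units_closed R.Units_inv_closed)
  also have "\<dots> = \<one>\<^bsub>UP \<R>\<^esub>" using A0 by simp
  finally have "A \<otimes>\<^bsub>UP \<R>\<^esub> ?C = \<one>\<^bsub>UP \<R>\<^esub>" .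
  moreover have "?C \<in> carrier (UP \<R>)" using A0 by simp
  ultimately show ?thesis using A(1) U.P.m_comm[of ?C A] by (auto simp: Units_def)
qed

text \<open>From P = A B one gets f = U A B. Both A_0 and B_0 divide p^m, so up to units A and B
  come from g and h in R[[X]], and g h divides f over R by descent. Irreducibility of f makes g or h
  a unit.\<close>

lemma irreducible_weierstrass_of_fps:
  assumes f: "\<not> fps_const p dvd f" and f0: "fps_nth f 0 dvd p ^ m"
    and irr: "Factorial_Ring.irreducible f"
  shows "ring_irreducible\<^bsub>UP \<R>\<^esub> (weierstrass_poly p f)"
proof (rule domain.ring_irreducibleI[OF U.UP_domain])
  let ?P = "weierstrass_poly p f"
  note P = weierstrass_poly_works[OF f]
  obtain n where n: "distinguished_poly n ?P" using P unfolding is_weierstrass_poly_def by blast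
  have "?P \<noteq> \<zero>\<^bsub>UP \<R>\<^esub>"
    using n U.R.one_not_zero by (auto simp: distinguished_poly_def up_zero_PS PS_zero)
  then show "?P \<in> carrier (UP \<R>) - {\<zero>\<^bsub>UP \<R>\<^esub>}" using is_weierstrass_poly_closed[OF P] by simp
  show "?P \<notin> Units (UP \<R>)"
    using is_weierstrass_poly_Units[OF P f0] irr by (simp add: Factorial_Ring.irreducible_def)
  fix A B assume A: "A \<in> carrier (UP \<R>)" and B: "B \<in> carrier (UP \<R>)" and AB: "?P = A \<otimes>\<^bsub>UP \<R>\<^esub> B"
  note Ac = up_carrier_PS[OF A] and Bc = up_carrier_PS[OF B]
  obtain U where U: "U \<in> Units \<S>" "\<phi> f = U \<otimes>\<^bsub>\<S>\<^esub> (A \<otimes>\<^bsub>\<S>\<^esub> B)"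
    using P A B unfolding is_weierstrass_poly_def AB by (auto simp: up_mult_PS)
  note Uc = S.Units_closed[OF U(1)]
  have c0: "A 0 \<in> carrier \<R>" "B 0 \<in> carrier \<R>" "U 0 \<in> carrier \<R>"
    using Ac Bc Uc by (auto simp: PS_carrier)
  obtain c where c: "p ^ m = fps_nth f 0 * c" using f0 by (rule dvdE)
  have "\<iota> (fps_nth f 0) = U 0 \<otimes>\<^bsub>\<R>\<^esub> (A 0 \<otimes>\<^bsub>\<R>\<^esub> B 0)"
    using arg_cong[OF U(2), of "\<lambda>F. F 0"] Ac Bc Uc by (simp add: PS_mult_0 fps_to_completion_def)
  then have eq: "\<iota> (p ^ m) = U 0 \<otimes>\<^bsub>\<R>\<^esub> (A 0 \<otimes>\<^bsub>\<R>\<^esub> B 0) \<otimes>\<^bsub>\<R>\<^esub> \<iota> c"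
    by (simp add: c completion_map_mult)
  \<comment> \<open>An explicit cofactor of \<open>A 0\<close> in p^m, as the descent of
    \<open>A\<close> requires.\<close>
  have "A 0 \<otimes>\<^bsub>\<R>\<^esub> (B 0 \<otimes>\<^bsub>\<R>\<^esub> (U 0 \<otimes>\<^bsub>\<R>\<^esub> \<iota> c)) = \<iota> (p ^ m)"
    unfolding eq using c0 by (simp add: R.m_ac)
  then obtain V g a where V: "V \<in> Units \<S>" "A \<otimes>\<^bsub>\<S>\<^esub> V = \<phi> g" and g: "fps_nth g 0 = p ^ a"
    using completion_divisor_descends[OF Ac] c0 by (metis R.m_closed completion_map_closed)
  have "B 0 \<otimes>\<^bsub>\<R>\<^esub> (A 0 \<otimes>\<^bsub>\<R>\<^esub> (U 0 \<otimes>\<^bsub>\<R>\<^esub> \<iota> c)) = \<iota> (p ^ m)"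
    unfolding eq using c0 by (simp add: R.m_ac)
  then obtain W h b where W: "W \<in> Units \<S>" "B \<otimes>\<^bsub>\<S>\<^esub> W = \<phi> h" and h: "fps_nth h 0 = p ^ b"
    using completion_divisor_descends[OF Bc] c0 by (metis R.m_closed completion_map_closed)
  note Vc = S.Units_closed[OF V(1)] S.Units_inv_closed[OF V(1)]
    and Wc = S.Units_closed[OF W(1)] S.Units_inv_closed[OF W(1)]
  have A_eq: "A = \<phi> g \<otimes>\<^bsub>\<S>\<^esub> inv\<^bsub>\<S>\<^esub> V"
    unfolding V(2)[symmetric] using Ac V(1) Vc by (simp add: S.m_assoc)
  have B_eq: "B = \<phi> h \<otimes>\<^bsub>\<S>\<^esub> inv\<^bsub>\<S>\<^esub> W"
    unfolding W(2)[symmetric] using Bc W(1) Wc by (simp add: S.m_assoc)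
  have "\<phi> f = \<phi> (g * h) \<otimes>\<^bsub>\<S>\<^esub> (U \<otimes>\<^bsub>\<S>\<^esub> (inv\<^bsub>\<S>\<^esub> V \<otimes>\<^bsub>\<S>\<^esub> inv\<^bsub>\<S>\<^esub> W))"
    unfolding U(2) using Uc Vc Wc by (subst A_eq, subst B_eq) (simp add: fps_map_mult S.m_ac)
  moreover have "fps_nth (g * h) 0 dvd p ^ (a + b)" by (simp add: g h power_add)
  ultimately have "g * h dvd f"
    using Uc Vc Wc by (intro fps_dvd_of_dvd_completion[of "g * h" "a + b"
          "U \<otimes>\<^bsub>\<S>\<^esub> (inv\<^bsub>\<S>\<^esub> V \<otimes>\<^bsub>\<S>\<^esub> inv\<^bsub>\<S>\<^esub> W)"]) auto
  \<comment> \<open>The remaining factor \<open>e\<close> is attached to \<open>h\<close>: if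
    \<open>h * e\<close> is a unit, so is \<open>h\<close>.\<close>
  then obtain e where "f = g * (h * e)" by (metis dvdE mult.assoc)
  then have "g dvd 1 \<or> h * e dvd 1" using irr by (metis Factorial_Ring.irreducibleD)
  then have "g dvd 1 \<or> h dvd 1" by (blast intro: dvd_mult_left)
  then have "A \<in> Units \<S> \<or> B \<in> Units \<S>"
    using fps_map_unit V(1) W(1) by (metis A_eq B_eq S.Units_inv_Units S.Units_m_closed)
  then show "A \<in> Units (UP \<R>) \<or> B \<in> Units (UP \<R>)"
    using distinguished_factor_Units[OF A _ B] distinguished_factor_Units[OF B _ A] n U.P.m_comm[OF A B]
    unfolding AB by metis
qed

text \<open>Polynomial multiples of P in \<open>\<S>\<close> are multiples in
  \<open>UP \<R>\<close>. Long division by the monic P gives Q = P q + r, and uniqueness of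
  Weierstrass division forces r = 0.\<close>

lemma weierstrass_multiple_in_ideal:
  assumes P: "is_weierstrass_poly f P" and Q: "Q \<in> carrier (UP \<R>)"
    and V: "V \<in> carrier \<S>" "Q = P \<otimes>\<^bsub>\<S>\<^esub> V"
  shows "Q \<in> PIdl\<^bsub>UP \<R>\<^esub> P"
proof -
  note Pc = is_weierstrass_poly_closed[OF P]
  obtain d where d: "distinguished d f" "distinguished_poly d P"
    using is_weierstrass_poly_distinguished[OF P] .
  obtain U where U: "U \<in> Units \<S>" "\<phi> f = U \<otimes>\<^bsub>\<S>\<^esub> P"
    using P unfolding is_weierstrass_poly_def by blast
  have Pd: "deg \<R> P = d" "P d = \<one>\<^bsub>\<R>\<^esub>"
    using distinguished_poly_deg[OF d(2)] d(2) by (auto simp: distinguished_poly_def)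
  have "P \<noteq> \<zero>\<^bsub>UP \<R>\<^esub>"
    using Pd U.R.one_not_zero by (auto simp: up_zero_PS PS_zero)
  from U.long_div_theorem[OF Pc(1) Q this] obtain q r where
    q: "q \<in> carrier (UP \<R>)" and r: "r \<in> carrier (UP \<R>)" "r = \<zero>\<^bsub>UP \<R>\<^esub> \<or> deg \<R> r < d"
    and eq: "Q = P \<otimes>\<^bsub>UP \<R>\<^esub> q \<oplus>\<^bsub>UP \<R>\<^esub> r"
    using Q by (auto simp: Pd up_coeff[OF Pc(1)])
  note qc = up_carrier_PS[OF q] and rc = up_carrier_PS[OF r(1)]
  have Uc: "inv\<^bsub>\<S>\<^esub> U \<in> carrier \<S>" using U(1) by simp
  have fU: "\<phi> f \<otimes>\<^bsub>\<S>\<^esub> inv\<^bsub>\<S>\<^esub> U = P"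
    unfolding U(2) using U(1) Pc(2) by (rule PS_Units_cancel)
  have "P \<otimes>\<^bsub>UP \<R>\<^esub> q \<in> carrier (UP \<R>)" using Pc q by simp
  then have eq': "P \<otimes>\<^bsub>\<S>\<^esub> V = P \<otimes>\<^bsub>\<S>\<^esub> q \<oplus>\<^bsub>\<S>\<^esub> r"
    using V(2) eq Pc q r by (simp add: up_add_PS up_mult_PS)
  \<comment> \<open>Uniqueness concerns division by \<open>\<phi> f\<close> rather than by P, so the
    unit between them is moved into the quotient.\<close>
  have "inv\<^bsub>\<S>\<^esub> U \<otimes>\<^bsub>\<S>\<^esub> (q \<ominus>\<^bsub>\<S>\<^esub> V) = \<zero>\<^bsub>\<S>\<^esub> \<and> r = \<zero>\<^bsub>\<S>\<^esub>"
  proof (rule weierstrass_division_unique[OF d(1)])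
    show "inv\<^bsub>\<S>\<^esub> U \<otimes>\<^bsub>\<S>\<^esub> (q \<ominus>\<^bsub>\<S>\<^esub> V) \<in> carrier \<S>" using Uc qc V by simp
    show "r \<in> carrier \<S>" by (rule rc)
    show "\<forall>i\<ge>d. r i = \<zero>\<^bsub>\<R>\<^esub>"
      using r U.deg_aboveD[OF _ r(1)] by (auto simp: up_zero_PS PS_zero up_coeff[OF r(1)])
    have *: "\<phi> f \<otimes>\<^bsub>\<S>\<^esub> (inv\<^bsub>\<S>\<^esub> U \<otimes>\<^bsub>\<S>\<^esub> (q \<ominus>\<^bsub>\<S>\<^esub> V)) = P \<otimes>\<^bsub>\<S>\<^esub> (q \<ominus>\<^bsub>\<S>\<^esub> V)"
      using Uc qc V(1) by (simp add: fU flip: S.m_assoc)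
    have "P \<otimes>\<^bsub>\<S>\<^esub> (q \<ominus>\<^bsub>\<S>\<^esub> V) \<oplus>\<^bsub>\<S>\<^esub> r = (P \<otimes>\<^bsub>\<S>\<^esub> q \<oplus>\<^bsub>\<S>\<^esub> r) \<ominus>\<^bsub>\<S>\<^esub> P \<otimes>\<^bsub>\<S>\<^esub> V"
      using Pc(2) qc V(1) rc by (simp add: a_minus_def S.r_distr S.r_minus S.a_ac)
    also have "\<dots> = \<zero>\<^bsub>\<S>\<^esub>" unfolding eq'[symmetric] using Pc(2) V(1) by simp
    finally show "\<phi> f \<otimes>\<^bsub>\<S>\<^esub> (inv\<^bsub>\<S>\<^esub> U \<otimes>\<^bsub>\<S>\<^esub> (q \<ominus>\<^bsub>\<S>\<^esub> V)) \<oplus>\<^bsub>\<S>\<^esub> r = \<zero>\<^bsub>\<S>\<^esub>"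
      unfolding * .
  qed
  then have "Q = q \<otimes>\<^bsub>UP \<R>\<^esub> P"
    using eq Pc q r U.P.m_comm[OF q Pc(1)] by (simp flip: up_zero_PS)
  then show ?thesis using q by (auto simp: cgenideal_def)
qed

section \<open>The isomorphism of quotient rings\<close>

lemma fps_ring_cring: "cring (fps_ring :: 'a fps ring)"
proof (rule cringI)
  show "abelian_group (fps_ring :: 'a fps ring)"
    by (rule abelian_groupI) (auto simp: fps_ring_def algebra_simps intro: exI[of _ "- x" for x])
  show "comm_monoid (fps_ring :: 'a fps ring)"
    by (rule comm_monoidI) (auto simp: fps_ring_def algebra_simps)
qed (auto simp: fps_ring_def algebra_simps)

lemma poly_map_closed: "poly_to_completion p q \<in> carrier (UP \<R>)"
  by (rule up_carrierI[of _ "Polynomial.degree q"])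
    (auto simp: PS_carrier poly_to_completion_def coeff_eq_0 completion_map_zero)

lemma poly_map_fps: "\<phi> (fps_of_poly q) = poly_to_completion p q"
  by (simp add: fps_to_completion_def poly_to_completion_def)

lemma PS_add_diff_cancel:
  assumes "x \<in> carrier \<S>" "y \<in> carrier \<S>"
  shows "(x \<oplus>\<^bsub>\<S>\<^esub> y) \<ominus>\<^bsub>\<S>\<^esub> x = y"
  using assms by (simp add: a_minus_def S.a_comm[of x y] S.a_assoc S.r_neg)

text \<open>F is sent to the class of the polynomials congruent to it modulo P in
  \<open>\<S>\<close>. Weierstrass division provides one, descent of divisibility identifies the
  kernel with (f), and remainders over R give surjectivity.\<close>

lemma weierstrass_quotient_iso:
  assumes f: "\<not> fps_const p dvd f" and f0: "fps_nth f 0 dvd p ^ m"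
  shows "\<exists>h \<in> ring_iso (fps_ring Quot (PIdl\<^bsub>fps_ring\<^esub> f))
                  (UP \<R> Quot (PIdl\<^bsub>UP \<R>\<^esub> (weierstrass_poly p f))).
              \<forall>q. h ((PIdl\<^bsub>fps_ring\<^esub> f) +>\<^bsub>fps_ring\<^esub> fps_of_poly q)
                  = (PIdl\<^bsub>UP \<R>\<^esub> (weierstrass_poly p f)) +>\<^bsub>UP \<R>\<^esub> poly_to_completion p q"
proof -
  let ?P = "weierstrass_poly p f" and ?K = "UP \<R>"
  let ?I = "PIdl\<^bsub>?K\<^esub> ?P"
  note P = weierstrass_poly_works[OF f]
  note Pc = is_weierstrass_poly_closed[OF P]
  obtain d where d: "distinguished d f" using distinguished_exists[OF f] .
  obtain U where U: "U \<in> Units \<S>" "\<phi> f = U \<otimes>\<^bsub>\<S>\<^esub> ?P"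
    using P unfolding is_weierstrass_poly_def by blast
  have Uc: "U \<in> carrier \<S>" "inv\<^bsub>\<S>\<^esub> U \<in> carrier \<S>" using U(1) by auto
  have fU: "\<phi> f \<otimes>\<^bsub>\<S>\<^esub> inv\<^bsub>\<S>\<^esub> U = ?P"
    unfolding U(2) using U(1) Pc(2) by (rule PS_Units_cancel)
  interpret F: cring "fps_ring :: 'a fps ring" by (rule fps_ring_cring)
  interpret I: ideal ?I ?K using Pc(1) by (rule U.P.cgenideal_ideal)
  \<comment> \<open>The value is the set of all such polynomials. It turns out to be a coset of
    \<open>?I\<close>, so no representative has to be chosen.\<close>
  define \<Psi> where "\<Psi> F = {Q \<in> carrier ?K. \<exists>V\<in>carrier \<S>. \<phi> F = ?P \<otimes>\<^bsub>\<S>\<^esub> V \<oplus>\<^bsub>\<S>\<^esub> Q}" for F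
  have \<Psi>_coset: "\<Psi> F = ?I +>\<^bsub>?K\<^esub> Q" if Q: "Q \<in> \<Psi> F" for F Q
  proof -
    obtain V where QU: "Q \<in> carrier ?K" and V: "V \<in> carrier \<S>" "\<phi> F = ?P \<otimes>\<^bsub>\<S>\<^esub> V \<oplus>\<^bsub>\<S>\<^esub> Q"
      using Q by (auto simp: \<Psi>_def)
    note Qc = up_carrier_PS[OF QU]
    show ?thesis
    proof (intro equalityI subsetI)
      fix Q' assume "Q' \<in> \<Psi> F"
      then obtain V' where QU': "Q' \<in> carrier ?K" and V': "V' \<in> carrier \<S>" "\<phi> F = ?P \<otimes>\<^bsub>\<S>\<^esub> V' \<oplus>\<^bsub>\<S>\<^esub> Q'"
        by (auto simp: \<Psi>_def)
      note Qc' = up_carrier_PS[OF QU']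
      let ?D = "Q' \<ominus>\<^bsub>?K\<^esub> Q"
      have D: "?D \<in> carrier ?K" "?D \<oplus>\<^bsub>?K\<^esub> Q = Q'"
        using QU QU' by (simp_all add: a_minus_def U.P.a_assoc U.P.l_neg)
      note Dc = up_carrier_PS[OF D(1)]
      have DQ: "Q' = ?D \<oplus>\<^bsub>\<S>\<^esub> Q" using D QU by (simp add: up_add_PS)
      have "?P \<otimes>\<^bsub>\<S>\<^esub> V \<oplus>\<^bsub>\<S>\<^esub> Q = (?P \<otimes>\<^bsub>\<S>\<^esub> V' \<oplus>\<^bsub>\<S>\<^esub> ?D) \<oplus>\<^bsub>\<S>\<^esub> Q"
        using V(2) V'(2) V'(1) DQ Pc Dc Qc by (metis S.a_assoc S.m_closed)
      then have "?P \<otimes>\<^bsub>\<S>\<^esub> V = ?P \<otimes>\<^bsub>\<S>\<^esub> V' \<oplus>\<^bsub>\<S>\<^esub> ?D"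
        using V V' Pc Dc Qc by simp
      then have "?P \<otimes>\<^bsub>\<S>\<^esub> (V \<ominus>\<^bsub>\<S>\<^esub> V') = (?P \<otimes>\<^bsub>\<S>\<^esub> V' \<oplus>\<^bsub>\<S>\<^esub> ?D) \<ominus>\<^bsub>\<S>\<^esub> ?P \<otimes>\<^bsub>\<S>\<^esub> V'"
        using V(1) V'(1) Pc by (simp add: a_minus_def S.r_distr S.r_minus)
      also have "\<dots> = ?D"
        using V'(1) Pc(2) Dc by (intro PS_add_diff_cancel) simp_all
      finally have "?D \<in> ?I"
        using V(1) V'(1) by (intro weierstrass_multiple_in_ideal[OF P D(1), of "V \<ominus>\<^bsub>\<S>\<^esub> V'"]) simp_all
      then show "Q' \<in> ?I +>\<^bsub>?K\<^esub> Q"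
        unfolding a_r_coset_def' by (intro UN_I[of ?D]) (simp_all add: D(2))
    next
      fix Q' assume "Q' \<in> ?I +>\<^bsub>?K\<^esub> Q"
      then obtain y where y: "y \<in> carrier ?K" "Q' = (y \<otimes>\<^bsub>?K\<^esub> ?P) \<oplus>\<^bsub>?K\<^esub> Q"
        unfolding a_r_coset_def' cgenideal_def by blast
      note yc = up_carrier_PS[OF y(1)]
      have QU': "Q' \<in> carrier ?K" using y QU Pc by simp
      have "y \<otimes>\<^bsub>?K\<^esub> ?P \<in> carrier ?K" using y Pc by simp
      then have "Q' = (y \<otimes>\<^bsub>\<S>\<^esub> ?P) \<oplus>\<^bsub>\<S>\<^esub> Q"
        using y QU Pc by (simp add: up_add_PS up_mult_PS)
      then have "?P \<otimes>\<^bsub>\<S>\<^esub> (V \<ominus>\<^bsub>\<S>\<^esub> y) \<oplus>\<^bsub>\<S>\<^esub> Q'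
          = ?P \<otimes>\<^bsub>\<S>\<^esub> V \<oplus>\<^bsub>\<S>\<^esub> (\<ominus>\<^bsub>\<S>\<^esub> (?P \<otimes>\<^bsub>\<S>\<^esub> y) \<oplus>\<^bsub>\<S>\<^esub> (?P \<otimes>\<^bsub>\<S>\<^esub> y)) \<oplus>\<^bsub>\<S>\<^esub> Q"
        using V(1) yc Pc(2) Qc S.m_comm[OF yc Pc(2)] by (simp add: a_minus_def S.r_distr S.r_minus S.a_assoc)
      also have "\<dots> = \<phi> F" using V yc Pc(2) Qc by (simp add: S.l_neg)
      finally show "Q' \<in> \<Psi> F"
        unfolding \<Psi>_def using QU' V(1) yc by (auto intro!: bexI[of _ "V \<ominus>\<^bsub>\<S>\<^esub> y"])
    qed
  qed
  have \<Psi>_ex: "\<exists>Q. Q \<in> \<Psi> F" for F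
  proof -
    obtain q r where q: "q \<in> carrier \<S>" and r: "r \<in> carrier \<S>" "\<forall>i\<ge>d. r i = \<zero>\<^bsub>\<R>\<^esub>"
      and eq: "\<phi> F = \<phi> f \<otimes>\<^bsub>\<S>\<^esub> q \<oplus>\<^bsub>\<S>\<^esub> r"
      by (rule weierstrass_division[OF d fps_map_closed])
    have "r \<in> carrier ?K" by (rule up_carrierI[OF r(1), of d]) (use r(2) in simp)
    moreover have "\<phi> F = ?P \<otimes>\<^bsub>\<S>\<^esub> (U \<otimes>\<^bsub>\<S>\<^esub> q) \<oplus>\<^bsub>\<S>\<^esub> r"
      unfolding eq U(2) using Uc q Pc(2) by (simp add: S.m_ac)
    ultimately have "r \<in> \<Psi> F" using Uc q by (auto simp: \<Psi>_def)
    then show ?thesis by blast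
  qed
  have \<Psi>_closed: "Q \<in> carrier ?K" if "Q \<in> \<Psi> F" for F Q using that by (simp add: \<Psi>_def)
  have \<Psi>_add: "Q \<oplus>\<^bsub>?K\<^esub> Q' \<in> \<Psi> (F + F')" if "Q \<in> \<Psi> F" "Q' \<in> \<Psi> F'" for F F' Q Q'
  proof -
    from that obtain V V' where Q: "Q \<in> carrier ?K" "Q' \<in> carrier ?K" and V: "V \<in> carrier \<S>" "V' \<in> carrier \<S>"
      and eq: "\<phi> F = ?P \<otimes>\<^bsub>\<S>\<^esub> V \<oplus>\<^bsub>\<S>\<^esub> Q" "\<phi> F' = ?P \<otimes>\<^bsub>\<S>\<^esub> V' \<oplus>\<^bsub>\<S>\<^esub> Q'"
      unfolding \<Psi>_def by blast
    note Qc = up_carrier_PS[OF Q(1)] up_carrier_PS[OF Q(2)]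
    have "\<phi> (F + F') = ?P \<otimes>\<^bsub>\<S>\<^esub> (V \<oplus>\<^bsub>\<S>\<^esub> V') \<oplus>\<^bsub>\<S>\<^esub> (Q \<oplus>\<^bsub>\<S>\<^esub> Q')"
      unfolding fps_map_add eq using V Qc Pc(2) by (simp add: S.r_distr S.a_ac)
    then show ?thesis using V Q by (auto simp: \<Psi>_def up_add_PS[symmetric])
  qed
  have \<Psi>_mult: "Q \<otimes>\<^bsub>?K\<^esub> Q' \<in> \<Psi> (F * F')" if "Q \<in> \<Psi> F" "Q' \<in> \<Psi> F'" for F F' Q Q'
  proof -
    from that obtain V V' where Q: "Q \<in> carrier ?K" "Q' \<in> carrier ?K" and V: "V \<in> carrier \<S>" "V' \<in> carrier \<S>"
      and eq: "\<phi> F = ?P \<otimes>\<^bsub>\<S>\<^esub> V \<oplus>\<^bsub>\<S>\<^esub> Q" "\<phi> F' = ?P \<otimes>\<^bsub>\<S>\<^esub> V' \<oplus>\<^bsub>\<S>\<^esub> Q'"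
      unfolding \<Psi>_def by blast
    note Qc = up_carrier_PS[OF Q(1)] up_carrier_PS[OF Q(2)]
    let ?V = "V \<otimes>\<^bsub>\<S>\<^esub> (?P \<otimes>\<^bsub>\<S>\<^esub> V' \<oplus>\<^bsub>\<S>\<^esub> Q') \<oplus>\<^bsub>\<S>\<^esub> Q \<otimes>\<^bsub>\<S>\<^esub> V'"
    have "\<phi> (F * F') = ?P \<otimes>\<^bsub>\<S>\<^esub> ?V \<oplus>\<^bsub>\<S>\<^esub> (Q \<otimes>\<^bsub>\<S>\<^esub> Q')"
      unfolding fps_map_mult eq using V Qc Pc(2) by (simp add: S.l_distr S.r_distr S.a_ac S.m_ac)
    moreover have "?V \<in> carrier \<S>" using V Qc Pc(2) by simp
    ultimately show ?thesis using Q by (auto simp: \<Psi>_def up_mult_PS[symmetric])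
  qed
  \<comment> \<open>A polynomial over R needs no reduction; this yields compatibility with the
    R[X]-algebra structures.\<close>
  have \<Psi>_poly: "poly_to_completion p q \<in> \<Psi> (fps_of_poly q)" for q
    using poly_map_closed Pc(2) up_carrier_PS[OF poly_map_closed]
    by (auto simp: \<Psi>_def poly_map_fps intro!: bexI[of _ "\<zero>\<^bsub>\<S>\<^esub>"])
  have \<Psi>_zero: "\<Psi> F = ?I \<longleftrightarrow> f dvd F" for F
  proof -
    have I0: "?I +>\<^bsub>?K\<^esub> \<zero>\<^bsub>?K\<^esub> = ?I" using I.a_subset by simp
    have "\<Psi> F = ?I \<longleftrightarrow> \<zero>\<^bsub>?K\<^esub> \<in> \<Psi> F"
      using \<Psi>_coset[of "\<zero>\<^bsub>?K\<^esub>" F] I0 I.zero_closed by auto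
    also have "\<dots> \<longleftrightarrow> (\<exists>V\<in>carrier \<S>. \<phi> F = ?P \<otimes>\<^bsub>\<S>\<^esub> V)"
      using Pc(2) by (auto simp: \<Psi>_def up_zero_PS)
        (metis S.m_closed S.r_zero U.P.zero_closed up_zero_PS)+
    also have "\<dots> \<longleftrightarrow> f dvd F"
    proof
      assume "\<exists>V\<in>carrier \<S>. \<phi> F = ?P \<otimes>\<^bsub>\<S>\<^esub> V"
      then obtain V where V: "V \<in> carrier \<S>" "\<phi> F = ?P \<otimes>\<^bsub>\<S>\<^esub> V" by blast
      then have "\<phi> F = \<phi> f \<otimes>\<^bsub>\<S>\<^esub> (inv\<^bsub>\<S>\<^esub> U \<otimes>\<^bsub>\<S>\<^esub> V)"
        using Uc by (simp add: fU flip: S.m_assoc)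
      with f0 show "f dvd F" using Uc V(1) by (intro fps_dvd_of_dvd_completion) simp_all
    next
      assume "f dvd F"
      then obtain G where "F = f * G" by (rule dvdE)
      then have "\<phi> F = ?P \<otimes>\<^bsub>\<S>\<^esub> (U \<otimes>\<^bsub>\<S>\<^esub> \<phi> G)"
        using Uc Pc(2) by (simp add: fps_map_mult U(2) S.m_ac)
      then show "\<exists>V\<in>carrier \<S>. \<phi> F = ?P \<otimes>\<^bsub>\<S>\<^esub> V" using Uc by blast
    qed
    finally show ?thesis .
  qed
  have hom: "\<Psi> \<in> ring_hom fps_ring (?K Quot ?I)"
  proof (rule ring_hom_memI)
    fix F F' :: "'a fps"
    obtain Q Q' where Q: "Q \<in> \<Psi> F" "Q' \<in> \<Psi> F'" using \<Psi>_ex by metis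
    note Qc = \<Psi>_closed[OF Q(1)] \<Psi>_closed[OF Q(2)]
    show "\<Psi> F \<in> carrier (?K Quot ?I)"
      using \<Psi>_coset[OF Q(1)] U.P.a_rcosetsI[OF I.a_subset Qc(1)] by (simp add: FactRing_def)
    show "\<Psi> (F \<otimes>\<^bsub>fps_ring\<^esub> F') = \<Psi> F \<otimes>\<^bsub>?K Quot ?I\<^esub> \<Psi> F'"
      using \<Psi>_coset[OF \<Psi>_mult[OF Q]] \<Psi>_coset[OF Q(1)] \<Psi>_coset[OF Q(2)] I.rcoset_mult_add[OF Qc]
      by (simp add: fps_ring_def FactRing_def)
    show "\<Psi> (F \<oplus>\<^bsub>fps_ring\<^esub> F') = \<Psi> F \<oplus>\<^bsub>?K Quot ?I\<^esub> \<Psi> F'"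
      using \<Psi>_coset[OF \<Psi>_add[OF Q]] \<Psi>_coset[OF Q(1)] \<Psi>_coset[OF Q(2)] I.a_rcos_sum[OF Qc]
      by (simp add: fps_ring_def FactRing_def)
  next
    have "poly_to_completion p 1 = \<one>\<^bsub>?K\<^esub>"
      using poly_map_fps[of 1] fps_map_one by (simp add: up_one_PS)
    then show "\<Psi> \<one>\<^bsub>fps_ring\<^esub> = \<one>\<^bsub>?K Quot ?I\<^esub>"
      using \<Psi>_coset[OF \<Psi>_poly[of 1]] by (simp add: fps_ring_def FactRing_def)
  qed
  interpret H: ring_hom_ring "fps_ring :: 'a fps ring" "?K Quot ?I" \<Psi>
    by (rule ring_hom_ringI2[OF F.ring_axioms I.quotient_is_ring hom])
  have zero_quot: "\<zero>\<^bsub>?K Quot ?I\<^esub> = ?I" by (simp only: FactRing_def ring_record_simps)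
  have ker: "a_kernel fps_ring (?K Quot ?I) \<Psi> = PIdl\<^bsub>fps_ring\<^esub> f"
  proof -
    have "a_kernel fps_ring (?K Quot ?I) \<Psi> = {F. \<Psi> F = ?I}"
      unfolding a_kernel_def' zero_quot by (simp add: fps_ring_def)
    also have "\<dots> = {F. f dvd F}" by (simp add: \<Psi>_zero)
    also have "\<dots> = PIdl\<^bsub>fps_ring\<^esub> f"
      by (auto simp: cgenideal_def fps_ring_def dvd_def mult.commute)
    finally show ?thesis .
  qed
  have surj: "\<Psi> ` carrier fps_ring = carrier (?K Quot ?I)"
  proof (intro equalityI subsetI)
    fix C assume "C \<in> carrier (?K Quot ?I)"
    then obtain Q where QU: "Q \<in> carrier ?K" and C: "C = ?I +>\<^bsub>?K\<^esub> Q"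
      by (auto simp: FactRing_def A_RCOSETS_def')
    note Qc = up_carrier_PS[OF QU]
    \<comment> \<open>As f_0 divides p^m, \<open>Q\<close> can be decomposed along f; the remainder
      \<open>G\<close> over R is a preimage of the coset.\<close>
    obtain c where c: "p ^ m = fps_nth f 0 * c" using f0 by (rule dvdE)
    have "\<phi> f 0 \<otimes>\<^bsub>\<R>\<^esub> \<iota> c = \<iota> (p ^ m)"
      by (simp add: c completion_map_mult fps_to_completion_def)
    moreover have "Q 0 \<in> carrier \<R>" using Qc by (simp add: PS_carrier)
    then obtain r s where s: "s \<in> carrier \<R>" "Q 0 = \<iota> (p ^ m) \<otimes>\<^bsub>\<R>\<^esub> s \<oplus>\<^bsub>\<R>\<^esub> \<iota> r"
      by (rule completion_approx)
    ultimately have "Q 0 = \<phi> f 0 \<otimes>\<^bsub>\<R>\<^esub> (\<iota> c \<otimes>\<^bsub>\<R>\<^esub> s) \<oplus>\<^bsub>\<R>\<^esub> \<iota> r"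
      by (simp add: fps_to_completion_def flip: R.m_assoc)
    then obtain V G where V: "V \<in> carrier \<S>" and eq: "Q = \<phi> f \<otimes>\<^bsub>\<S>\<^esub> V \<oplus>\<^bsub>\<S>\<^esub> \<phi> G"
      using PS_decompose[OF fps_map_closed Qc completion_map_closed \<open>\<phi> f 0 \<otimes>\<^bsub>\<R>\<^esub> \<iota> c = \<iota> (p ^ m)\<close>]
        s(1) by (metis R.m_closed completion_map_closed)
    have "?P \<otimes>\<^bsub>\<S>\<^esub> (\<ominus>\<^bsub>\<S>\<^esub> (U \<otimes>\<^bsub>\<S>\<^esub> V)) = \<ominus>\<^bsub>\<S>\<^esub> (\<phi> f \<otimes>\<^bsub>\<S>\<^esub> V)"
      using Uc V Pc(2) by (simp add: U(2) S.r_minus S.m_ac)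
    then have "\<phi> G = ?P \<otimes>\<^bsub>\<S>\<^esub> (\<ominus>\<^bsub>\<S>\<^esub> (U \<otimes>\<^bsub>\<S>\<^esub> V)) \<oplus>\<^bsub>\<S>\<^esub> Q"
      unfolding eq using V by (simp add: S.l_neg flip: S.a_assoc)
    then have "Q \<in> \<Psi> G" using QU Uc V by (auto simp: \<Psi>_def)
    then have "C = \<Psi> G" using C \<Psi>_coset by simp
    then show "C \<in> \<Psi> ` carrier fps_ring" by (simp add: fps_ring_def)
  qed auto
  show ?thesis
  proof (intro bexI allI)
    \<comment> \<open>The map induced by \<open>\<Psi>\<close> on cosets of its kernel;
      \<open>the_elem\<close> extracts the common value on a coset.\<close>
    show "(\<lambda>X. the_elem (\<Psi> ` X)) \<in> ring_iso (fps_ring Quot (PIdl\<^bsub>fps_ring\<^esub> f)) (?K Quot ?I)"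
      using H.FactRing_iso_set[OF surj] by (simp add: ker)
    fix q
    have "the_elem (\<Psi> ` ((PIdl\<^bsub>fps_ring\<^esub> f) +>\<^bsub>fps_ring\<^esub> fps_of_poly q)) = \<Psi> (fps_of_poly q)"
      unfolding ker[symmetric] by (rule H.the_elem_simp) (simp add: fps_ring_def)
    then show "the_elem (\<Psi> ` ((PIdl\<^bsub>fps_ring\<^esub> f) +>\<^bsub>fps_ring\<^esub> fps_of_poly q))
        = ?I +>\<^bsub>?K\<^esub> poly_to_completion p q"
      using \<Psi>_coset[OF \<Psi>_poly] by simp
  qed
qed

end

section \<open>The irreducibility criterion\<close>

lemma irreducible_fps_prime_times_unit:
  fixes f :: "'a::idom fps"
  assumes p: "prime_elem p" and f: "f dvd 1"
  shows "Factorial_Ring.irreducible (fps_const p * f)"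
proof (rule Factorial_Ring.irreducibleI)
  have p0: "p \<noteq> 0" "\<not> p dvd 1" using p by (auto simp: prime_elem_def)
  show "fps_const p * f \<noteq> 0" using p0 f by auto
  show "\<not> fps_const p * f dvd 1"
    using p0 by (auto simp: fps_is_unit_iff dest: dvd_mult_left)
  fix g h assume gh: "fps_const p * f = g * h"
  \<comment> \<open>When p divides one constant term, cancelling p shows that the other one divides
    the unit f_0.\<close>
  have unit: "y dvd 1" if "p dvd x" "p * fps_nth f 0 = x * y" for x y
  proof -
    from that(1) obtain t where "x = p * t" by (rule dvdE)
    then have "fps_nth f 0 = t * y" using that(2) p0(1) by (simp add: mult.assoc)
    with f show ?thesis by (auto simp: fps_is_unit_iff dest: dvd_mult_right)
  qed
  have eq: "p * fps_nth f 0 = fps_nth g 0 * fps_nth h 0"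
    using arg_cong[OF gh, of "\<lambda>F. fps_nth F 0"] by simp
  then have "p dvd fps_nth g 0 \<or> p dvd fps_nth h 0"
    using p by (metis dvd_triv_left prime_elem_dvd_multD)
  then show "g dvd 1 \<or> h dvd 1"
    using unit[of "fps_nth g 0" "fps_nth h 0"] unit[of "fps_nth h 0" "fps_nth g 0"] eq
    by (auto simp: fps_is_unit_iff mult.commute)
qed

theorem theorem1p4:
  fixes f :: "'a::idom fps"
  assumes PID: "all_ideals_principal TYPE('a)"
  shows "(Factorial_Ring.irreducible f \<longleftrightarrow>
            ((fps_nth f 0 = 0 \<and> fps_nth f 1 dvd 1) \<or>
             (\<exists>p :: 'a. prime_elem p \<and>
                (\<exists>m. fps_nth f 0 dvd p ^ m \<and> p ^ m dvd fps_nth f 0) \<and>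
                (\<exists>k f'. f = fps_const (p ^ k) * f' \<and> \<not> fps_const p dvd f' \<and>
                   ((k = 1 \<and> fps_nth f' 0 dvd 1) \<or>
                    (k = 0 \<and> ring_irreducible\<^bsub>UP (padic_completion p)\<^esub> (weierstrass_poly p f)))))))
       \<and>
         (\<forall>p :: 'a. \<forall>m. prime_elem p \<and> fps_nth f 0 dvd p ^ m \<and> p ^ m dvd fps_nth f 0
             \<and> \<not> fps_const p dvd f \<longrightarrow>
           (\<exists>h \<in> ring_iso (fps_ring Quot (PIdl\<^bsub>fps_ring\<^esub> f))
                  (UP (padic_completion p) Quot (PIdl\<^bsub>UP (padic_completion p)\<^esub> (weierstrass_poly p f))).
              \<forall>q :: 'a poly.
                h ((PIdl\<^bsub>fps_ring\<^esub> f) +>\<^bsub>fps_ring\<^esub> fps_of_poly q)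
                  = (PIdl\<^bsub>UP (padic_completion p)\<^esub> (weierstrass_poly p f))
                      +>\<^bsub>UP (padic_completion p)\<^esub> poly_to_completion p q))"
proof (intro conjI iffI allI impI)
  \<comment> \<open>In a principal ideal domain every prime has a residue field, so the local theory
    applies to each p.\<close>
  have locale_p: "prime_residue_field p" if "prime_elem p" for p :: 'a
    using that PID_inverse_mod_prime[OF PID that] by unfold_locales
  {
    assume irr: "Factorial_Ring.irreducible f"
    show "(fps_nth f 0 = 0 \<and> fps_nth f 1 dvd 1) \<or>
             (\<exists>p :: 'a. prime_elem p \<and>
                (\<exists>m. fps_nth f 0 dvd p ^ m \<and> p ^ m dvd fps_nth f 0) \<and>
                (\<exists>k f'. f = fps_const (p ^ k) * f' \<and> \<not> fps_const p dvd f' \<and>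
                   ((k = 1 \<and> fps_nth f' 0 dvd 1) \<or>
                    (k = 0 \<and> ring_irreducible\<^bsub>UP (padic_completion p)\<^esub> (weierstrass_poly p f)))))"
    proof (cases "fps_nth f 0 = 0")
      case True
      then show ?thesis using irreducible_fps_const_0[OF irr] by blast
    next
      case False
      then obtain p m where p: "prime_elem p" and m: "fps_nth f 0 dvd p ^ m" "p ^ m dvd fps_nth f 0"
        using irreducible_fps_const_primepow[OF PID irr] by blast
      interpret prime_residue_field p using p by (rule locale_p)
      have "\<exists>k f'. f = fps_const (p ^ k) * f' \<and> \<not> fps_const p dvd f' \<and>
          ((k = 1 \<and> fps_nth f' 0 dvd 1) \<or>
           (k = 0 \<and> ring_irreducible\<^bsub>UP (padic_completion p)\<^esub> (weierstrass_poly p f)))"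
      \<comment> \<open>If p divides f, irreducibility leaves only p times a unit, hence k = 1;
        otherwise k = 0 and f' = f.\<close>
      proof (cases "fps_const p dvd f")
        case True
        then obtain f' where f': "f = fps_const p * f'" by (rule dvdE)
        have "\<not> fps_const p dvd (1 :: 'a fps)"
          using p by (simp add: fps_is_unit_iff prime_elem_def)
        moreover from this have "f' dvd 1" using irr f' by (metis Factorial_Ring.irreducibleD)
        ultimately have "\<not> fps_const p dvd f'" "fps_nth f' 0 dvd 1"
          by (blast intro: dvd_trans) (use \<open>f' dvd 1\<close> in \<open>simp add: fps_is_unit_iff\<close>)
        with f' show ?thesis by (intro exI[of _ 1] exI[of _ f']) simp
      next
        case False
        then show ?thesis using irreducible_weierstrass_of_fps[OF False m(1) irr]
          by (intro exI[of _ 0] exI[of _ f]) simp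
      qed
      then show ?thesis using p m by blast
    qed
  next
    assume "(fps_nth f 0 = 0 \<and> fps_nth f 1 dvd 1) \<or>
             (\<exists>p :: 'a. prime_elem p \<and>
                (\<exists>m. fps_nth f 0 dvd p ^ m \<and> p ^ m dvd fps_nth f 0) \<and>
                (\<exists>k f'. f = fps_const (p ^ k) * f' \<and> \<not> fps_const p dvd f' \<and>
                   ((k = 1 \<and> fps_nth f' 0 dvd 1) \<or>
                    (k = 0 \<and> ring_irreducible\<^bsub>UP (padic_completion p)\<^esub> (weierstrass_poly p f)))))"
    then show "Factorial_Ring.irreducible f"
    proof
      assume "\<exists>p :: 'a. prime_elem p \<and>
                (\<exists>m. fps_nth f 0 dvd p ^ m \<and> p ^ m dvd fps_nth f 0) \<and>
                (\<exists>k f'. f = fps_const (p ^ k) * f' \<and> \<not> fps_const p dvd f' \<and>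
                   ((k = 1 \<and> fps_nth f' 0 dvd 1) \<or>
                    (k = 0 \<and> ring_irreducible\<^bsub>UP (padic_completion p)\<^esub> (weierstrass_poly p f))))"
      then obtain p m k f' where p: "prime_elem p" and m: "fps_nth f 0 dvd p ^ m"
        and f': "f = fps_const (p ^ k) * f'" "\<not> fps_const p dvd f'"
        and k: "(k = 1 \<and> fps_nth f' 0 dvd 1) \<or>
          (k = 0 \<and> ring_irreducible\<^bsub>UP (padic_completion p)\<^esub> (weierstrass_poly p f))"
        by blast
      interpret prime_residue_field p using p by (rule locale_p)
      from k show ?thesis
      proof
        assume "k = 1 \<and> fps_nth f' 0 dvd 1"
        then show ?thesis using irreducible_fps_prime_times_unit[OF p] f' by (simp add: fps_is_unit_iff)
      next
        assume "k = 0 \<and> ring_irreducible\<^bsub>UP (padic_completion p)\<^esub> (weierstrass_poly p f)"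
        then have "\<not> fps_const p dvd f" "ring_irreducible\<^bsub>UP \<R>\<^esub> (weierstrass_poly p f)"
          using f' by auto
        then show ?thesis using irreducible_fps_of_weierstrass m by blast
      qed
    qed (use irreducible_fps_order_one in blast)
  next
    fix p :: 'a and m
    assume *: "prime_elem p \<and> fps_nth f 0 dvd p ^ m \<and> p ^ m dvd fps_nth f 0 \<and> \<not> fps_const p dvd f"
    then interpret prime_residue_field p by (intro locale_p) simp
    show "\<exists>h \<in> ring_iso (fps_ring Quot (PIdl\<^bsub>fps_ring\<^esub> f))
                  (UP (padic_completion p) Quot (PIdl\<^bsub>UP (padic_completion p)\<^esub> (weierstrass_poly p f))).
              \<forall>q :: 'a poly.
                h ((PIdl\<^bsub>fps_ring\<^esub> f) +>\<^bsub>fps_ring\<^esub> fps_of_poly q)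
                  = (PIdl\<^bsub>UP (padic_completion p)\<^esub> (weierstrass_poly p f))
                      +>\<^bsub>UP (padic_completion p)\<^esub> poly_to_completion p q"
      using * weierstrass_quotient_iso by blast
  }
qed

end
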